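(* Let $G$ be a finite simple connected graph which is complete intersection. Then exactly one of the following holds: (1) all blocks of $G$ are bipartite; (2) all blocks of $G$ are bipartite except one; (3) all blocks of $G$ are bipartite except two, and these two blocks are contiguous.
   Context: For a finite simple graph $G$ with edges $e_1,\dots,e_m$ and a field $K$, the toric ideal $I_G\subseteq K[e_1,\dots,e_m]$ is the kernel of the $K$-algebra map $e_i=\{v_j,v_k\}\mapsto v_jv_k$; $G$ is complete intersection if $I_G$ is generated by $\operatorname{ht}(I_G)$ elements. A block of $G$ is a maximal connected subgraph without cut vertex (a maximal biconnected subgraph). Two blocks of $G$ are called contiguous if there is a path from one to the other in which each edge of the path belongs to a different block of $G$. *)

theory Defs
  imports "HOL-Library.Poly_Mapping" "HOL-Library.Extended_Nat"
begin

section \<open>Commutative algebra relative to a subring carrier R of a commutative ring type\<close>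

definition ideal_in :: "'a::comm_ring_1 set \<Rightarrow> 'a set \<Rightarrow> bool" where
  "ideal_in R I \<longleftrightarrow> I \<subseteq> R \<and> 0 \<in> I \<and> (\<forall>a\<in>I. \<forall>b\<in>I. a + b \<in> I \<and> a - b \<in> I)
     \<and> (\<forall>r\<in>R. \<forall>a\<in>I. r * a \<in> I)"

definition prime_ideal_in :: "'a::comm_ring_1 set \<Rightarrow> 'a set \<Rightarrow> bool" where
  "prime_ideal_in R P \<longleftrightarrow> ideal_in R P \<and> P \<noteq> R \<and>
     (\<forall>a\<in>R. \<forall>b\<in>R. a * b \<in> P \<longrightarrow> a \<in> P \<or> b \<in> P)"

definition prime_height :: "'a::comm_ring_1 set \<Rightarrow> 'a set \<Rightarrow> enat" where
  "prime_height R P = Sup {enat n | n. \<exists>c :: nat \<Rightarrow> 'a set.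
      (\<forall>i\<le>n. prime_ideal_in R (c i)) \<and> (\<forall>i<n. c i \<subset> c (Suc i)) \<and> c n = P}"

definition ideal_height :: "'a::comm_ring_1 set \<Rightarrow> 'a set \<Rightarrow> enat" where
  "ideal_height R I = Inf {prime_height R P | P. prime_ideal_in R P \<and> I \<subseteq> P}"

definition ideal_gen :: "'a::comm_ring_1 set \<Rightarrow> 'a list \<Rightarrow> 'a set" where
  "ideal_gen R gs = {\<Sum>i<length gs. r i * gs ! i | r. \<forall>i. r i \<in> R}"

definition complete_intersection_in :: "'a::comm_ring_1 set \<Rightarrow> 'a set \<Rightarrow> bool" where
  "complete_intersection_in R I \<longleftrightarrow>
     (\<exists>gs. set gs \<subseteq> R \<and> I = ideal_gen R gs \<and> enat (length gs) = ideal_height R I)"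

definition simple_graph :: "'v set \<Rightarrow> 'v set set \<Rightarrow> bool" where
  "simple_graph V E \<longleftrightarrow> finite V \<and> (\<forall>e\<in>E. e \<subseteq> V \<and> card e = 2)"

definition edge_ring :: "'v set set \<Rightarrow> (('v set \<Rightarrow>\<^sub>0 nat) \<Rightarrow>\<^sub>0 'k::field) set" where
  "edge_ring E = {p. \<forall>\<alpha>\<in>Poly_Mapping.keys p. Poly_Mapping.keys \<alpha> \<subseteq> E}"

definition edge_mono_image :: "('v set \<Rightarrow>\<^sub>0 nat) \<Rightarrow> ('v \<Rightarrow>\<^sub>0 nat)" where
  "edge_mono_image \<alpha> = (\<Sum>e\<in>Poly_Mapping.keys \<alpha>. \<Sum>v\<in>e. Poly_Mapping.single v (Poly_Mapping.lookup \<alpha> e))"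

text \<open>The K-algebra map K[E] -> K[V], e = {u,w} |-> u w.\<close>
definition toric_map :: "(('v set \<Rightarrow>\<^sub>0 nat) \<Rightarrow>\<^sub>0 'k::field) \<Rightarrow> (('v \<Rightarrow>\<^sub>0 nat) \<Rightarrow>\<^sub>0 'k)" where
  "toric_map p = (\<Sum>\<alpha>\<in>Poly_Mapping.keys p. Poly_Mapping.single (edge_mono_image \<alpha>) (Poly_Mapping.lookup p \<alpha>))"

definition toric_ideal :: "'v set set \<Rightarrow> (('v set \<Rightarrow>\<^sub>0 nat) \<Rightarrow>\<^sub>0 'k::field) set" where
  "toric_ideal E = {p \<in> edge_ring E. toric_map p = 0}"

definition graph_complete_intersection :: "'k::field itself \<Rightarrow> 'v set set \<Rightarrow> bool" where
  "graph_complete_intersection _ E \<longleftrightarrow>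
     complete_intersection_in (edge_ring E :: (('v set \<Rightarrow>\<^sub>0 nat) \<Rightarrow>\<^sub>0 'k) set) (toric_ideal E)"

definition joined :: "'v set \<Rightarrow> 'v set set \<Rightarrow> 'v \<Rightarrow> 'v \<Rightarrow> bool" where
  "joined V E x y \<longleftrightarrow> (\<exists>xs. xs \<noteq> [] \<and> hd xs = x \<and> last xs = y \<and> set xs \<subseteq> V \<and>
      (\<forall>i. Suc i < length xs \<longrightarrow> {xs ! i, xs ! Suc i} \<in> E))"

definition connected_graph :: "'v set \<Rightarrow> 'v set set \<Rightarrow> bool" where
  "connected_graph V E \<longleftrightarrow> V \<noteq> {} \<and> (\<forall>x\<in>V. \<forall>y\<in>V. joined V E x y)"

definition subgraph :: "'v set \<times> 'v set set \<Rightarrow> 'v set \<times> 'v set set \<Rightarrow> bool" where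
  "subgraph H G \<longleftrightarrow> fst H \<subseteq> fst G \<and> snd H \<subseteq> snd G \<and> (\<forall>e\<in>snd H. e \<subseteq> fst H)"

definition cut_vertex :: "'v set \<times> 'v set set \<Rightarrow> 'v \<Rightarrow> bool" where
  "cut_vertex H v \<longleftrightarrow> v \<in> fst H \<and> (\<exists>x\<in>fst H - {v}. \<exists>y\<in>fst H - {v}.
      joined (fst H) (snd H) x y \<and>
      \<not> joined (fst H - {v}) {e \<in> snd H. v \<notin> e} x y)"

definition biconnected_sub :: "'v set \<times> 'v set set \<Rightarrow> 'v set \<times> 'v set set \<Rightarrow> bool" where
  "biconnected_sub G H \<longleftrightarrow> subgraph H G \<and> connected_graph (fst H) (snd H) \<and> (\<forall>v. \<not> cut_vertex H v)"

definition is_block :: "'v set \<times> 'v set set \<Rightarrow> 'v set \<times> 'v set set \<Rightarrow> bool" where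
  "is_block G B \<longleftrightarrow> biconnected_sub G B \<and>
     (\<forall>H. biconnected_sub G H \<and> subgraph B H \<longrightarrow> H = B)"

definition bipartite :: "'v set \<times> 'v set set \<Rightarrow> bool" where
  "bipartite H \<longleftrightarrow> (\<exists>c :: 'v \<Rightarrow> bool. \<forall>e\<in>snd H. \<forall>x\<in>e. \<forall>y\<in>e. x \<noteq> y \<longrightarrow> c x \<noteq> c y)"

definition contiguous :: "'v set \<times> 'v set set \<Rightarrow> 'v set \<times> 'v set set \<Rightarrow> 'v set \<times> 'v set set \<Rightarrow> bool" where
  "contiguous G B1 B2 \<longleftrightarrow> (\<exists>xs f. xs \<noteq> [] \<and> hd xs \<in> fst B1 \<and> last xs \<in> fst B2 \<and>
      distinct xs \<and> set xs \<subseteq> fst G \<and>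
      (\<forall>i. Suc i < length xs \<longrightarrow> {xs ! i, xs ! Suc i} \<in> snd G \<and>
           is_block G (f i) \<and> {xs ! i, xs ! Suc i} \<in> snd (f i)) \<and>
      inj_on f {i. Suc i < length xs})"

end

theory Submission
  imports Defs "HOL-Library.FuncSet"
begin

text \<open>
  Every chain of primes ending in the toric ideal \<open>I\<close> has length at most \<open>m - r\<close>, where \<open>m\<close> is the
  number of edges and \<open>r\<close> the rank of the incidence matrix. So if \<open>I\<close> is a complete intersection, a
  minimal set of binomial generators has at most \<open>m - r\<close> elements; as their exponent vectors span
  the lattice of integer relations among the edges, they form a basis \<open>T\<close> of it, and for every vertex
  set \<open>W\<close> the elements of \<open>T\<close> supported in \<open>W\<close> span the relations supported in \<open>W\<close>.

  Let a cut vertex \<open>c\<close> separate two non-bipartite blocks. A relation with zero flow through \<open>c\<close> splits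
  into relations on the two sides, so exactly one element of \<open>T\<close> has nonzero flow through \<open>c\<close>. If
  \<open>W\<^sub>1\<close> and \<open>W\<^sub>2\<close> both carry a relation with nonzero flow, then both contain that element, hence so
  does \<open>W\<^sub>1 \<inter> W\<^sub>2\<close>. An induced connected subgraph containing both blocks carries such a relation,
  while one which is bipartite on one side of \<open>c\<close> does not. Suitable choices of \<open>W\<^sub>1\<close> and \<open>W\<^sub>2\<close>, built
  from shortest paths between blocks, exclude a third non-bipartite block and show that every
  inner vertex of a shortest path between two non-bipartite blocks separates them.
\<close>

text \<open>The given generators need be neither binomials nor homogeneous, so they cannot be
  compared with exponent vectors directly. The comparison passes through \<open>I / \<mm>I\<close>,
  with \<open>\<mm>\<close> the ideal of the origin: every generating list spans this space over
  \<open>K\<close>, so binomials independent there are at most as many as the generators. A largest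
  such set yields all relations by induction on degree. The restriction to \<open>W\<close> survives
  because \<open>I\<close> is graded by the vertices: a monomial with the same image as a monomial
  supported in \<open>W\<close> is itself supported in \<open>W\<close>.

  The bound on chains is a growth count: a chain of length \<open>n\<close> together with
  \<open>r\<close> independent edges yields \<open>(d + 1)^(r + n)\<close> independent polynomials
  with exponents \<open>O(d)\<close>, while only \<open>O(d^m)\<close> monomials are available.

  Flow through \<open>c\<close> is the right invariant because cutting a relation at
  \<open>c\<close> leaves relations on both sides exactly if the incidence at \<open>c\<close>
  vanishes on each of them. A non-bipartite side supplies incidence 2 at \<open>c\<close>, whereas a
  bipartite side forces 0.\<close>

abbreviation coef :: "('a \<Rightarrow>\<^sub>0 'b::zero) \<Rightarrow> 'a \<Rightarrow> 'b" where
  "coef \<equiv> Poly_Mapping.lookup"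

abbreviation supp :: "('a \<Rightarrow>\<^sub>0 'b::zero) \<Rightarrow> 'a set" where
  "supp \<equiv> Poly_Mapping.keys"

abbreviation monom :: "'a \<Rightarrow> 'b::zero \<Rightarrow> ('a \<Rightarrow>\<^sub>0 'b)" where
  "monom \<equiv> Poly_Mapping.single"

section \<open>Linear algebra and linear functionals on polynomials\<close>

text \<open>Gaussian elimination: a pivot \<open>a0\<close> clears coordinate \<open>b\<close> from
  the other vectors, and its own coefficient \<open>s\<close> is then solved from that coordinate.
  The dimension counts below, over \<open>K\<close> and over the rationals, reduce to this.\<close>

lemma exists_nontrivial_relation:
  fixes M :: "'a \<Rightarrow> 'b \<Rightarrow> 'k::field"
  assumes "finite B" "finite A" "card B < card A"
  shows "\<exists>c. (\<exists>a\<in>A. c a \<noteq> 0) \<and> (\<forall>b\<in>B. (\<Sum>a\<in>A. c a * M a b) = 0)"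
  using assms
proof (induction B arbitrary: A M rule: finite_induct)
  case empty
  then have "A \<noteq> {}" by auto
  then show ?case by (intro exI[of _ "\<lambda>_. 1"]) auto
next
  case (insert b B)
  show ?case
  proof (cases "\<forall>a\<in>A. M a b = 0")
    case True
    have "card B < card A" using insert by simp
    from insert.IH[OF insert.prems(1) this, of M] obtain c where
      "\<exists>a\<in>A. c a \<noteq> 0" "\<forall>b\<in>B. (\<Sum>a\<in>A. c a * M a b) = 0" by auto
    then show ?thesis using True by (intro exI[of _ c]) auto
  next
    case False
    then obtain a0 where a0: "a0 \<in> A" "M a0 b \<noteq> 0" by auto
    define A' where "A' = A - {a0}"
    have A': "finite A'" "A = insert a0 A'" "a0 \<notin> A'" using a0 insert.prems by (auto simp: A'_def)
    define M' where "M' a x = M a x - M a b / M a0 b * M a0 x" for a x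
    have "card B < card A'" using A' insert by simp
    from insert.IH[OF A'(1) this, of M'] obtain c where
      c: "\<exists>a\<in>A'. c a \<noteq> 0" "\<forall>x\<in>B. (\<Sum>a\<in>A'. c a * M' a x) = 0" by auto
    define s where "s = - (\<Sum>a\<in>A'. c a * M a b) / M a0 b"
    define c' where "c' = c(a0 := s)"
    have sum_c': "(\<Sum>a\<in>A. c' a * M a x) = s * M a0 x + (\<Sum>a\<in>A'. c a * M a x)" for x
    proof -
      have "(\<Sum>a\<in>A'. c' a * M a x) = (\<Sum>a\<in>A'. c a * M a x)"
        using A'(3) by (intro sum.cong) (auto simp: c'_def)
      then show ?thesis using A' by (simp add: c'_def)
    qed
    have "(\<Sum>a\<in>A. c' a * M a x) = 0" if "x \<in> insert b B" for x
    proof (cases "x = b")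
      case True
      then show ?thesis using a0 by (simp add: sum_c' s_def)
    next
      case False
      then have "(\<Sum>a\<in>A'. c a * M' a x) = 0" using c that by auto
      then have "(\<Sum>a\<in>A'. c a * M a x) = (\<Sum>a\<in>A'. c a * M a b) / M a0 b * M a0 x"
        by (simp add: M'_def right_diff_distrib sum_subtractf sum_distrib_right
            sum_divide_distrib mult.assoc)
      then show ?thesis by (simp add: sum_c' s_def)
    qed
    moreover have "\<exists>a\<in>A. c' a \<noteq> 0" using c A' by (auto simp: c'_def)
    ultimately show ?thesis by blast
  qed
qed

text \<open>The linear extension of \<open>\<phi>\<close> from monomials to polynomials.
  Coefficients, coefficients of the toric map and the functionals on \<open>I / \<mm>I\<close> are
  all of this form, so that one product formula, \<open>lin_mult\<close>, serves them all.\<close>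

definition lin :: "('a \<Rightarrow> 'k) \<Rightarrow> ('a \<Rightarrow>\<^sub>0 'k::comm_ring_1) \<Rightarrow> 'k" where
  "lin \<phi> f = (\<Sum>\<alpha>\<in>supp f. coef f \<alpha> * \<phi> \<alpha>)"

lemma lin_superset:
  assumes "finite S" "supp f \<subseteq> S"
  shows "lin \<phi> f = (\<Sum>\<alpha>\<in>S. coef f \<alpha> * \<phi> \<alpha>)"
  unfolding lin_def using assms
  by (intro sum.mono_neutral_left) (auto simp: in_keys_iff)

lemma lin_zero [simp]: "lin \<phi> 0 = 0"
  by (simp add: lin_def)

lemma lin_single [simp]: "lin \<phi> (monom \<alpha> c) = c * \<phi> \<alpha>"
  by (simp add: lin_def)

lemma lin_add: "lin \<phi> (f + g) = lin \<phi> f + lin \<phi> g"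
proof -
  have "supp (f + g) \<subseteq> supp f \<union> supp g" by (rule keys_add)
  then show ?thesis
    by (simp add: lin_superset[of "supp f \<union> supp g"] lookup_add distrib_right sum.distrib)
qed

lemma lin_diff: "lin \<phi> (f - g) = lin \<phi> f - lin \<phi> g"
  using lin_add[of \<phi> "f - g" g] by (simp add: algebra_simps)

lemma lin_sum: "lin \<phi> (sum f A) = (\<Sum>a\<in>A. lin \<phi> (f a))"
  by (induction A rule: infinite_finite_induct) (auto simp: lin_add)

lemma poly_eq_sum_monom: "f = (\<Sum>\<alpha>\<in>supp f. monom \<alpha> (coef f \<alpha>))"
  by (rule poly_mapping_eqI)
    (auto simp: lookup_sum lookup_single when_def sum.delta in_keys_iff)

lemma mult_eq_sum_monom:
  fixes f g :: "'a::comm_monoid_add \<Rightarrow>\<^sub>0 'k::comm_ring_1"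
  shows "f * g = (\<Sum>\<alpha>\<in>supp f. \<Sum>\<beta>\<in>supp g. monom (\<alpha> + \<beta>) (coef f \<alpha> * coef g \<beta>))"
proof -
  have "f * g = (\<Sum>\<alpha>\<in>supp f. monom \<alpha> (coef f \<alpha>)) * (\<Sum>\<alpha>\<in>supp g. monom \<alpha> (coef g \<alpha>))"
    using poly_eq_sum_monom[of f] poly_eq_sum_monom[of g] by simp
  then show ?thesis by (simp add: sum_product mult_single)
qed

lemma lin_mult:
  fixes f g :: "'a::comm_monoid_add \<Rightarrow>\<^sub>0 'k::comm_ring_1"
  shows "lin \<phi> (f * g) = (\<Sum>\<alpha>\<in>supp f. coef f \<alpha> * lin (\<lambda>\<beta>. \<phi> (\<alpha> + \<beta>)) g)"
  by (subst mult_eq_sum_monom) (simp add: lin_sum, simp add: lin_def sum_distrib_left mult.assoc)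

lemma coef_eq_lin: "coef f k = lin (\<lambda>\<alpha>. if \<alpha> = k then 1 else 0) f"
  by (simp add: lin_def in_keys_iff if_distrib cong: if_cong)

text \<open>The leading monomials of \<open>p\<close> and \<open>q\<close> have a product that
  arises from no other pair of monomials, so its coefficient is a product of two nonzero
  scalars.\<close>

lemma poly_mult_nonzero:
  fixes p q :: "('a \<Rightarrow>\<^sub>0 nat) \<Rightarrow>\<^sub>0 'k::field"
  assumes "p \<noteq> 0" "q \<noteq> 0"
  shows "p * q \<noteq> 0"
proof -
  define X where "X = (\<Union>\<alpha>\<in>supp p \<union> supp q. supp \<alpha>)"
  have "finite X" by (simp add: X_def)
  obtain idx :: "'a \<Rightarrow> nat" where idx: "inj_on idx X"
    using finite_imp_inj_to_nat_seg[OF \<open>finite X\<close>] by auto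
  \<comment> \<open>the lexicographic order on exponents needs linearly ordered variables\<close>
  define \<psi> :: "('a \<Rightarrow>\<^sub>0 nat) \<Rightarrow> (nat \<Rightarrow>\<^sub>0 nat)" where
    "\<psi> \<alpha> = (\<Sum>x\<in>X. monom (idx x) (coef \<alpha> x))" for \<alpha>
  have \<psi>_add: "\<psi> (\<alpha> + \<beta>) = \<psi> \<alpha> + \<psi> \<beta>" for \<alpha> \<beta>
    by (simp add: \<psi>_def lookup_add single_add sum.distrib)
  have coef_\<psi>: "coef (\<psi> \<alpha>) (idx x) = coef \<alpha> x" if "x \<in> X" for \<alpha> x
  proof -
    have "coef (\<psi> \<alpha>) (idx x) = (\<Sum>y\<in>X. if y = x then coef \<alpha> y else 0)"
      unfolding \<psi>_def lookup_sum lookup_single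
      using idx that by (intro sum.cong) (auto simp: when_def inj_on_eq_iff)
    then show ?thesis using that \<open>finite X\<close> by simp
  qed
  have \<psi>_inj: "\<alpha> = \<beta>" if "\<psi> \<alpha> = \<psi> \<beta>" "supp \<alpha> \<subseteq> X" "supp \<beta> \<subseteq> X" for \<alpha> \<beta>
  proof (rule poly_mapping_eqI)
    fix x show "coef \<alpha> x = coef \<beta> x"
    proof (cases "x \<in> X")
      case True
      then show ?thesis using coef_\<psi>[of x \<alpha>] coef_\<psi>[of x \<beta>] that(1) by simp
    next
      case False
      then have "x \<notin> supp \<alpha>" "x \<notin> supp \<beta>" using that by auto
      then show ?thesis by (simp add: in_keys_iff)
    qed
  qed
  have max: "\<exists>a\<in>supp r. \<forall>a'\<in>supp r. \<psi> a' \<le> \<psi> a" if "r \<noteq> 0" for r :: "('a \<Rightarrow>\<^sub>0 nat) \<Rightarrow>\<^sub>0 'k"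
  proof -
    have "supp r \<noteq> {}" using that by (auto simp: keys_eq_empty)
    then have "Max (\<psi> ` supp r) \<in> \<psi> ` supp r" by (intro Max_in) auto
    then obtain a where "a \<in> supp r" "Max (\<psi> ` supp r) = \<psi> a" by auto
    moreover have "\<psi> a' \<le> Max (\<psi> ` supp r)" if "a' \<in> supp r" for a'
      using that by (intro Max_ge) auto
    ultimately show ?thesis by metis
  qed
  obtain a where a: "a \<in> supp p" "\<forall>a'\<in>supp p. \<psi> a' \<le> \<psi> a" using max[OF assms(1)] by auto
  obtain b where b: "b \<in> supp q" "\<forall>b'\<in>supp q. \<psi> b' \<le> \<psi> b" using max[OF assms(2)] by auto
  have only: "a' = a \<and> b' = b" if "a' \<in> supp p" "b' \<in> supp q" "a' + b' = a + b" for a' b'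
  proof -
    have *: "\<psi> a' + \<psi> b' = \<psi> a + \<psi> b" using that by (metis \<psi>_add)
    have le: "\<psi> a' \<le> \<psi> a" "\<psi> b' \<le> \<psi> b" using a b that by auto
    have "\<psi> a' = \<psi> a"
    proof (rule ccontr)
      assume "\<psi> a' \<noteq> \<psi> a"
      then have "\<psi> a' < \<psi> a" using le by simp
      then have "\<psi> a' + \<psi> b' < \<psi> a + \<psi> b" using le by (intro add_less_le_mono)
      then show False using * by simp
    qed
    then have "a' = a" using that(1) a(1) by (intro \<psi>_inj) (auto simp: X_def)
    then show ?thesis using that by simp
  qed
  have "coef (p * q) (a + b) = (\<Sum>a'\<in>supp p. \<Sum>b'\<in>supp q.
      coef p a' * (coef q b' * (if a' + b' = a + b then 1 else 0)))"
    by (subst coef_eq_lin, subst lin_mult) (simp only: lin_def sum_distrib_left)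
  also have "\<dots> = (\<Sum>a'\<in>supp p. \<Sum>b'\<in>supp q.
      if a' = a then if b' = b then coef p a * coef q b else 0 else 0)"
    using only by (intro sum.cong refl) auto
  also have "\<dots> = (\<Sum>a'\<in>supp p. if a' = a then coef p a * coef q b else 0)"
    using b by (intro sum.cong refl) auto
  also have "\<dots> = coef p a * coef q b" using a by simp
  finally have "coef (p * q) (a + b) \<noteq> 0" using a b by (simp add: in_keys_iff)
  then show ?thesis by auto
qed

section \<open>The toric ideal of a graph\<close>

lemma edge_mono_image_superset:
  assumes "finite S" "supp \<alpha> \<subseteq> S"
  shows "edge_mono_image \<alpha> = (\<Sum>e\<in>S. \<Sum>v\<in>e. monom v (coef \<alpha> e))"
  unfolding edge_mono_image_def using assms
  by (intro sum.mono_neutral_left) (auto simp: in_keys_iff)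

lemma edge_mono_image_add:
  "edge_mono_image (\<alpha> + \<beta>) = edge_mono_image \<alpha> + edge_mono_image \<beta>"
proof -
  have "supp (\<alpha> + \<beta>) \<subseteq> supp \<alpha> \<union> supp \<beta>" by (rule keys_add)
  then show ?thesis
    by (simp add: edge_mono_image_superset[of "supp \<alpha> \<union> supp \<beta>"] lookup_add single_add sum.distrib)
qed

lemma edge_mono_image_zero [simp]: "edge_mono_image 0 = 0"
  by (simp add: edge_mono_image_def)

lemma coef_edge_mono_image:
  assumes "finite S" "supp \<alpha> \<subseteq> S" "\<And>e. e \<in> S \<Longrightarrow> finite e"
  shows "coef (edge_mono_image \<alpha>) v = (\<Sum>e | e \<in> S \<and> v \<in> e. coef \<alpha> e)"
proof -
  have "coef (edge_mono_image \<alpha>) v = (\<Sum>e\<in>S. \<Sum>w\<in>e. if w = v then coef \<alpha> e else 0)"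
    by (simp add: edge_mono_image_superset[OF assms(1,2)] lookup_sum lookup_single when_def)
  also have "\<dots> = (\<Sum>e\<in>S. if v \<in> e then coef \<alpha> e else 0)"
    using assms(3) by (intro sum.cong refl) simp
  also have "\<dots> = (\<Sum>e | e \<in> S \<and> v \<in> e. coef \<alpha> e)"
    using assms(1) by (simp add: sum.inter_filter)
  finally show ?thesis .
qed

lemma coef_toric_map:
  "coef (toric_map f) b = lin (\<lambda>\<alpha>. if edge_mono_image \<alpha> = b then 1 else 0) f"
  unfolding toric_map_def lin_def lookup_sum lookup_single
  by (intro sum.cong refl) (auto simp: when_def)

lemma toric_map_add: "toric_map (f + g) = toric_map f + toric_map g"
  by (rule poly_mapping_eqI) (simp add: coef_toric_map lookup_add lin_add)

lemma toric_map_diff: "toric_map (f - g) = toric_map f - toric_map g"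
  by (rule poly_mapping_eqI) (simp add: coef_toric_map lookup_minus lin_diff)

lemma toric_map_zero [simp]: "toric_map 0 = 0"
  by (simp add: toric_map_def)

lemma toric_map_monom [simp]: "toric_map (monom \<alpha> c) = monom (edge_mono_image \<alpha>) c"
  by (simp add: toric_map_def)

lemma toric_map_sum: "toric_map (sum f A) = (\<Sum>a\<in>A. toric_map (f a))"
  by (induction A rule: infinite_finite_induct) (auto simp: toric_map_add)

lemma toric_map_mult: "toric_map (f * g) = toric_map f * toric_map g"
proof -
  have "toric_map (f * g) = (\<Sum>\<alpha>\<in>supp f. \<Sum>\<beta>\<in>supp g.
      monom (edge_mono_image \<alpha> + edge_mono_image \<beta>) (coef f \<alpha> * coef g \<beta>))"
    by (subst mult_eq_sum_monom) (simp add: toric_map_sum edge_mono_image_add)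
  also have "\<dots> = toric_map f * toric_map g"
    by (simp add: toric_map_def[of f] toric_map_def[of g] sum_product mult_single)
  finally show ?thesis .
qed

lemma edge_ring_monom: "supp \<alpha> \<subseteq> E \<Longrightarrow> monom \<alpha> c \<in> edge_ring E"
  by (simp add: edge_ring_def)

lemma edge_ring_zero: "0 \<in> edge_ring E"
  by (simp add: edge_ring_def)

lemma edge_ring_one: "1 \<in> edge_ring E"
  by (simp add: edge_ring_def)

lemma edge_ring_add: "f \<in> edge_ring E \<Longrightarrow> g \<in> edge_ring E \<Longrightarrow> f + g \<in> edge_ring E"
  unfolding edge_ring_def using keys_add[of f g] by blast

lemma edge_ring_diff: "f \<in> edge_ring E \<Longrightarrow> g \<in> edge_ring E \<Longrightarrow> f - g \<in> edge_ring E"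
  unfolding edge_ring_def using keys_diff[of f g] by blast

lemma edge_ring_mult:
  assumes "f \<in> edge_ring E" "g \<in> edge_ring E"
  shows "f * g \<in> edge_ring E"
  unfolding edge_ring_def
proof (intro CollectI ballI)
  fix \<alpha> assume "\<alpha> \<in> supp (f * g)"
  then obtain a b where "\<alpha> = a + b" "a \<in> supp f" "b \<in> supp g" using keys_mult[of f g] by blast
  then show "supp \<alpha> \<subseteq> E" using assms keys_add[of a b] by (fastforce simp: edge_ring_def)
qed

lemma edge_ring_sum: "(\<And>a. a \<in> A \<Longrightarrow> f a \<in> edge_ring E) \<Longrightarrow> sum f A \<in> edge_ring E"
  by (induction A rule: infinite_finite_induct) (auto simp: edge_ring_zero edge_ring_add)

lemma edge_ring_power: "f \<in> edge_ring E \<Longrightarrow> f ^ n \<in> edge_ring E"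
  by (induction n) (auto simp: edge_ring_one edge_ring_mult)

text \<open>The target ring \<open>K[V]\<close> has no zero divisors. Primality is what lets the
  height be bounded by the chains of primes that end in the toric ideal itself.\<close>

lemma toric_ideal_prime:
  "prime_ideal_in (edge_ring E) (toric_ideal E :: (('v set \<Rightarrow>\<^sub>0 nat) \<Rightarrow>\<^sub>0 'k::field) set)"
proof -
  let ?I = "toric_ideal E :: (('v set \<Rightarrow>\<^sub>0 nat) \<Rightarrow>\<^sub>0 'k) set"
  have "ideal_in (edge_ring E) ?I"
    by (auto simp: ideal_in_def toric_ideal_def edge_ring_zero edge_ring_add edge_ring_diff
        edge_ring_mult toric_map_add toric_map_diff toric_map_mult)
  moreover have "toric_map (1 :: ('v set \<Rightarrow>\<^sub>0 nat) \<Rightarrow>\<^sub>0 'k) = 1"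
    using toric_map_monom[of "0 :: 'v set \<Rightarrow>\<^sub>0 nat" "1 :: 'k"] by simp
  then have "1 \<notin> ?I" by (simp add: toric_ideal_def)
  then have "?I \<noteq> edge_ring E" using edge_ring_one by metis
  moreover have "a \<in> ?I \<or> b \<in> ?I" if "a \<in> edge_ring E" "b \<in> edge_ring E" "a * b \<in> ?I" for a b
    using that poly_mult_nonzero[of "toric_map a" "toric_map b"]
    by (auto simp: toric_ideal_def toric_map_mult)
  ultimately show ?thesis by (auto simp: prime_ideal_in_def)
qed

text \<open>Such a functional factors through the toric map: grouping the monomials of
  \<open>g\<close> by their image, the coefficients of each group add up to a coefficient of
  \<open>toric_map g\<close>, which is 0.\<close>

lemma lin_toric_ideal:
  assumes "g \<in> toric_ideal E"
    and "\<And>\<alpha> \<beta>. supp \<alpha> \<subseteq> E \<Longrightarrow> supp \<beta> \<subseteq> E \<Longrightarrow> edge_mono_image \<alpha> = edge_mono_image \<beta> \<Longrightarrow> \<psi> \<alpha> = \<psi> \<beta>"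
  shows "lin \<psi> g = 0"
proof -
  have sub: "supp \<alpha> \<subseteq> E" if "\<alpha> \<in> supp g" for \<alpha>
    using assms(1) that by (auto simp: toric_ideal_def edge_ring_def)
  have "(\<Sum>\<alpha> | \<alpha> \<in> supp g \<and> edge_mono_image \<alpha> = b. coef g \<alpha> * \<psi> \<alpha>) = 0"
    if b: "b \<in> edge_mono_image ` supp g" for b
  proof -
    obtain \<alpha>0 where \<alpha>0: "\<alpha>0 \<in> supp g" "b = edge_mono_image \<alpha>0" using b by auto
    have "(\<Sum>\<alpha> | \<alpha> \<in> supp g \<and> edge_mono_image \<alpha> = b. coef g \<alpha> * \<psi> \<alpha>)
        = (\<Sum>\<alpha> | \<alpha> \<in> supp g \<and> edge_mono_image \<alpha> = b. coef g \<alpha>) * \<psi> \<alpha>0"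
      unfolding sum_distrib_right using \<alpha>0 sub
      by (intro sum.cong refl) (auto intro!: arg_cong2[where f = times] assms(2))
    also have "(\<Sum>\<alpha> | \<alpha> \<in> supp g \<and> edge_mono_image \<alpha> = b. coef g \<alpha>) = coef (toric_map g) b"
      by (simp add: coef_toric_map lin_def sum.inter_filter if_distrib cong: if_cong)
    also have "\<dots> = 0" using assms(1) by (simp add: toric_ideal_def)
    finally show ?thesis by simp
  qed
  then show ?thesis
    unfolding lin_def by (subst sum.image_gen[of _ _ edge_mono_image]) auto
qed

section \<open>An upper bound for the height\<close>

lemma lin_monom_mult:
  fixes u :: "'a::comm_monoid_add \<Rightarrow>\<^sub>0 'k::comm_ring_1"
  shows "lin \<phi> (monom \<gamma> c * u) = c * lin (\<lambda>\<beta>. \<phi> (\<gamma> + \<beta>)) u"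
  by (cases "c = 0") (simp_all add: lin_mult)

lemma coef_const_mult:
  fixes u :: "'a::comm_monoid_add \<Rightarrow>\<^sub>0 'k::comm_ring_1"
  shows "coef (monom 0 c * u) \<alpha> = c * coef u \<alpha>"
  by (simp add: coef_eq_lin[of _ \<alpha>] lin_monom_mult)

text \<open>Scalars of \<open>K\<close> are the constant polynomials \<open>monom 0 c\<close>.
  Independence is stated for indexed families because for products such as \<open>f ^ j * u\<close>
  distinctness is itself a consequence of independence.\<close>

definition indep_mod ::
  "('a::comm_monoid_add \<Rightarrow>\<^sub>0 'k::field) set \<Rightarrow> 'i set \<Rightarrow> ('i \<Rightarrow> ('a \<Rightarrow>\<^sub>0 'k)) \<Rightarrow> bool" where
  "indep_mod P J g \<longleftrightarrow> finite J \<and>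
     (\<forall>c. (\<Sum>i\<in>J. monom 0 (c i) * g i) \<in> P \<longrightarrow> (\<forall>i\<in>J. c i = 0))"

lemma indep_mod_inj:
  assumes "indep_mod P J g" "0 \<in> P"
  shows "inj_on g J"
proof (rule inj_onI, rule ccontr)
  fix i j assume ij: "i \<in> J" "j \<in> J" "g i = g j" "i \<noteq> j"
  define c where "c x = (if x = i then 1 else if x = j then -1 else 0 :: 'b)" for x
  have fin: "finite J" using assms by (simp add: indep_mod_def)
  have "(\<Sum>x\<in>J. monom 0 (c x) * g x) = (\<Sum>x\<in>{i, j}. monom 0 (c x) * g x)"
    using ij fin by (intro sum.mono_neutral_right) (auto simp: c_def)
  also have "\<dots> = 0" using ij by (simp add: c_def single_uminus)
  finally have "c i = 0" using assms ij by (simp add: indep_mod_def)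
  then show False by (simp add: c_def)
qed

lemma indep_mod_image:
  assumes "indep_mod P J g" "0 \<in> P"
  shows "indep_mod P (g ` J) id" "card (g ` J) = card J"
proof -
  have inj: "inj_on g J" by (rule indep_mod_inj[OF assms])
  then show "card (g ` J) = card J" by (rule card_image)
  show "indep_mod P (g ` J) id"
    unfolding indep_mod_def
  proof (intro conjI allI impI ballI)
    show "finite (g ` J)" using assms by (simp add: indep_mod_def)
    fix c u assume "(\<Sum>i\<in>g ` J. monom 0 (c i) * id i) \<in> P" and u: "u \<in> g ` J"
    then have "(\<Sum>i\<in>J. monom 0 ((c \<circ> g) i) * g i) \<in> P"
      by (simp add: sum.reindex[OF inj] o_def)
    then have "\<forall>i\<in>J. (c \<circ> g) i = 0" using assms unfolding indep_mod_def by blast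
    then show "c u = 0" using u by auto
  qed
qed

text \<open>Modulo \<open>Q\<close> only the terms with \<open>j = 0\<close> survive, because
  \<open>f\<close> lies in \<open>Q\<close>; so their coefficients vanish. What remains is
  \<open>f\<close> times a relation of lower degree in \<open>f\<close>, and primality of
  \<open>P\<close> cancels \<open>f\<close>.\<close>

lemma indep_mod_powers_aux:
  fixes f :: "('v set \<Rightarrow>\<^sub>0 nat) \<Rightarrow>\<^sub>0 'k::field"
  assumes P: "prime_ideal_in (edge_ring E) P" and Q: "ideal_in (edge_ring E) Q"
    and PQ: "P \<subseteq> Q" and f: "f \<in> Q" "f \<notin> P"
    and U: "U \<subseteq> edge_ring E" "indep_mod Q U id"
    and "(\<Sum>j\<le>d. \<Sum>u\<in>U. monom 0 (c j u) * (f ^ j * u)) \<in> P"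
  shows "\<forall>j\<le>d. \<forall>u\<in>U. c j u = 0"
  using assms(8)
proof (induction d arbitrary: c)
  case 0
  then have "(\<Sum>u\<in>U. monom 0 (c 0 u) * id u) \<in> Q" using PQ by auto
  then have "\<forall>u\<in>U. c 0 u = 0" using U(2) unfolding indep_mod_def by blast
  then show ?case by simp
next
  case (Suc d)
  let ?R = "edge_ring E :: (('v set \<Rightarrow>\<^sub>0 nat) \<Rightarrow>\<^sub>0 'k) set"
  have fR: "f \<in> ?R" using Q f by (auto simp: ideal_in_def)
  define s where "s = (\<Sum>u\<in>U. monom 0 (c 0 u) * u)"
  define r where "r = (\<Sum>j\<le>d. \<Sum>u\<in>U. monom 0 (c (Suc j) u) * (f ^ j * u))"
  have "(\<Sum>j\<le>Suc d. \<Sum>u\<in>U. monom 0 (c j u) * (f ^ j * u)) = s + f * r"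
    unfolding sum.atMost_Suc_shift s_def r_def by (simp add: sum_distrib_left ac_simps)
  with Suc.prems have sP: "s + f * r \<in> P" by simp
  have rR: "r \<in> ?R" unfolding r_def using fR U(1)
    by (intro edge_ring_sum edge_ring_mult edge_ring_monom edge_ring_power) auto
  have "r * f \<in> Q" using Q rR f unfolding ideal_in_def by blast
  moreover have "s + f * r \<in> Q" using sP PQ by auto
  ultimately have "s + f * r - r * f \<in> Q" using Q unfolding ideal_in_def by blast
  then have "(\<Sum>u\<in>U. monom 0 (c 0 u) * id u) \<in> Q" by (simp add: s_def mult.commute)
  then have c0: "\<forall>u\<in>U. c 0 u = 0" using U(2) unfolding indep_mod_def by blast
  then have "s = 0" by (simp add: s_def)
  then have "f * r \<in> P" using sP by simp
  then have "r \<in> P" using P fR rR f(2) unfolding prime_ideal_in_def by blast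
  then have *: "\<forall>j\<le>d. \<forall>u\<in>U. c (Suc j) u = 0" unfolding r_def by (rule Suc.IH)
  show ?case
  proof (intro allI impI ballI)
    fix j u assume "j \<le> Suc d" "u \<in> U"
    then show "c j u = 0" using c0 * by (cases j) auto
  qed
qed

lemma indep_mod_powers:
  fixes f :: "('v set \<Rightarrow>\<^sub>0 nat) \<Rightarrow>\<^sub>0 'k::field"
  assumes "prime_ideal_in (edge_ring E) P" "ideal_in (edge_ring E) Q" "P \<subseteq> Q" "f \<in> Q" "f \<notin> P"
    and U: "U \<subseteq> edge_ring E" "indep_mod Q U id"
  shows "indep_mod P ({..d} \<times> U) (\<lambda>(j, u). f ^ j * u)"
  unfolding indep_mod_def
proof (intro conjI allI impI)
  show "finite ({..d} \<times> U)" using U by (simp add: indep_mod_def)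
  fix c assume "(\<Sum>i\<in>{..d} \<times> U. monom 0 (c i) * (case i of (j, u) \<Rightarrow> f ^ j * u)) \<in> P"
  then have "(\<Sum>j\<le>d. \<Sum>u\<in>U. monom 0 (curry c j u) * (f ^ j * u)) \<in> P"
    by (simp add: sum.cartesian_product case_prod_unfold)
  from indep_mod_powers_aux[OF assms this] show "\<forall>i\<in>{..d} \<times> U. c i = 0" by auto
qed

text \<open>Bounding each exponent separately, rather than the total degree, makes the number of
  available monomials an exact power, \<open>(N + 1) ^ card E\<close>.\<close>

definition exponents_le :: "nat \<Rightarrow> (('x \<Rightarrow>\<^sub>0 nat) \<Rightarrow>\<^sub>0 'k::zero) \<Rightarrow> bool" where
  "exponents_le N f \<longleftrightarrow> (\<forall>\<alpha>\<in>supp f. \<forall>e. coef \<alpha> e \<le> N)"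

lemma exponents_le_exists:
  fixes f :: "('x \<Rightarrow>\<^sub>0 nat) \<Rightarrow>\<^sub>0 'k::zero"
  shows "\<exists>N. exponents_le N f"
proof -
  define S where "S = (\<Union>\<alpha>\<in>supp f. coef \<alpha> ` supp \<alpha>)"
  have "finite S" by (simp add: S_def)
  then obtain N where N: "\<forall>n\<in>S. n \<le> N" using finite_nat_set_iff_bounded_le by auto
  have "coef \<alpha> e \<le> N" if "\<alpha> \<in> supp f" for \<alpha> e
  proof (cases "e \<in> supp \<alpha>")
    case True
    then show ?thesis using N that by (auto simp: S_def)
  next
    case False
    then show ?thesis by (simp add: in_keys_iff)
  qed
  then show ?thesis by (auto simp: exponents_le_def)
qed

lemma exponents_le_mult:
  fixes f g :: "('x \<Rightarrow>\<^sub>0 nat) \<Rightarrow>\<^sub>0 'k::comm_ring_1"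
  assumes "exponents_le M f" "exponents_le N g"
  shows "exponents_le (M + N) (f * g)"
  unfolding exponents_le_def
proof (intro ballI allI)
  fix \<alpha> e assume "\<alpha> \<in> supp (f * g)"
  then obtain a b where "\<alpha> = a + b" "a \<in> supp f" "b \<in> supp g" using keys_mult[of f g] by blast
  then show "coef \<alpha> e \<le> M + N" using assms by (auto simp: exponents_le_def lookup_add intro: add_mono)
qed

lemma exponents_le_power:
  fixes f :: "('x \<Rightarrow>\<^sub>0 nat) \<Rightarrow>\<^sub>0 'k::comm_ring_1"
  assumes "exponents_le M f"
  shows "exponents_le (j * M) (f ^ j)"
proof (induction j)
  case 0
  show ?case by (simp add: exponents_le_def)
next
  case (Suc j)
  show ?case using exponents_le_mult[OF assms Suc] by simp
qed

lemma exponents_le_mono: "exponents_le M f \<Longrightarrow> M \<le> N \<Longrightarrow> exponents_le N f"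
  unfolding exponents_le_def using order_trans by blast

definition box_monomials :: "'x set \<Rightarrow> nat \<Rightarrow> ('x \<Rightarrow>\<^sub>0 nat) set" where
  "box_monomials E N = {\<alpha>. supp \<alpha> \<subseteq> E \<and> (\<forall>e. coef \<alpha> e \<le> N)}"

lemma card_box_monomials:
  assumes "finite E"
  shows "finite (box_monomials E N)" "card (box_monomials E N) = (N + 1) ^ card E"
proof -
  have "bij_betw (\<lambda>\<alpha>. restrict (coef \<alpha>) E) (box_monomials E N) (PiE E (\<lambda>_. {..N}))"
  proof (rule bij_betwI')
    fix \<alpha> \<beta> :: "'a \<Rightarrow>\<^sub>0 nat"
    assume ab: "\<alpha> \<in> box_monomials E N" "\<beta> \<in> box_monomials E N"
    show "(restrict (coef \<alpha>) E = restrict (coef \<beta>) E) = (\<alpha> = \<beta>)"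
    proof
      assume eq: "restrict (coef \<alpha>) E = restrict (coef \<beta>) E"
      show "\<alpha> = \<beta>"
      proof (rule poly_mapping_eqI)
        fix e show "coef \<alpha> e = coef \<beta> e"
        proof (cases "e \<in> E")
          case True
          then show ?thesis using fun_cong[OF eq, of e] by simp
        next
          case False
          then have "e \<notin> supp \<alpha>" "e \<notin> supp \<beta>" using ab by (auto simp: box_monomials_def)
          then show ?thesis by (simp add: in_keys_iff)
        qed
      qed
    qed simp
  next
    fix \<alpha> :: "'a \<Rightarrow>\<^sub>0 nat" assume "\<alpha> \<in> box_monomials E N"
    then show "restrict (coef \<alpha>) E \<in> PiE E (\<lambda>_. {..N})" by (auto simp: box_monomials_def)
  next
    fix g :: "'a \<Rightarrow> nat" assume g: "g \<in> PiE E (\<lambda>_. {..N})"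
    define \<alpha> where "\<alpha> = Abs_poly_mapping (\<lambda>e. if e \<in> E then g e else 0)"
    have "finite {e. (if e \<in> E then g e else 0) \<noteq> 0}"
      by (rule finite_subset[OF _ assms]) auto
    then have coef: "coef \<alpha> e = (if e \<in> E then g e else 0)" for e
      by (simp add: \<alpha>_def)
    have "\<alpha> \<in> box_monomials E N"
      using g by (auto simp: box_monomials_def in_keys_iff coef split: if_splits)
    moreover have "g = restrict (coef \<alpha>) E"
      using g by (auto simp: coef fun_eq_iff PiE_def extensional_def)
    ultimately show "\<exists>\<alpha>\<in>box_monomials E N. g = restrict (coef \<alpha>) E" by blast
  qed
  moreover have "finite (PiE E (\<lambda>_. {..N}))" using assms by (simp add: finite_PiE)
  moreover have "card (PiE E (\<lambda>_. {..N})) = (N + 1) ^ card E" using assms by (simp add: card_PiE)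
  ultimately show "finite (box_monomials E N)" "card (box_monomials E N) = (N + 1) ^ card E"
    by (auto simp: bij_betw_finite bij_betw_same_card)
qed

text \<open>The elements of \<open>U\<close> lie in the \<open>K\<close>-space spanned by the
  monomials of the box. A larger \<open>U\<close> would have a nontrivial relation with sum 0, and 0
  lies in \<open>P\<close>.\<close>

lemma indep_mod_card_le:
  fixes U :: "(('v set \<Rightarrow>\<^sub>0 nat) \<Rightarrow>\<^sub>0 'k::field) set"
  assumes "finite E" "U \<subseteq> edge_ring E" "indep_mod P U id" "0 \<in> P" "\<And>u. u \<in> U \<Longrightarrow> exponents_le N u"
  shows "card U \<le> (N + 1) ^ card E"
proof (rule ccontr)
  assume "\<not> ?thesis"
  then have "card (box_monomials E N) < card U" using card_box_monomials[OF assms(1), of N] by simp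
  moreover have "finite U" using assms by (simp add: indep_mod_def)
  ultimately obtain c where c: "\<exists>u\<in>U. c u \<noteq> 0"
    "\<forall>\<alpha>\<in>box_monomials E N. (\<Sum>u\<in>U. c u * coef u \<alpha>) = 0"
    using exists_nontrivial_relation[OF card_box_monomials(1)[OF assms(1)], of U N coef] by blast
  have "(\<Sum>u\<in>U. monom 0 (c u) * id u) = 0"
  proof (rule poly_mapping_eqI)
    fix \<alpha>
    have "(\<Sum>u\<in>U. c u * coef u \<alpha>) = 0"
    proof (cases "\<alpha> \<in> box_monomials E N")
      case False
      then have "\<alpha> \<notin> supp u" if "u \<in> U" for u
        using assms(2,5) that by (auto simp: box_monomials_def edge_ring_def exponents_le_def)
      then show ?thesis by (simp add: in_keys_iff)
    qed (use c in auto)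
    then show "coef (\<Sum>u\<in>U. monom 0 (c u) * id u) \<alpha> = coef 0 \<alpha>"
      by (simp add: lookup_sum coef_const_mult)
  qed
  then have "(\<Sum>u\<in>U. monom 0 (c u) * id u) \<in> P" using assms(4) by simp
  then have "\<forall>u\<in>U. c u = 0" using assms(3) unfolding indep_mod_def by blast
  then show False using c by blast
qed

text \<open>For edges of a graph this says that their incidence vectors are linearly independent
  over the rationals, so a maximal such \<open>F\<close> has as many elements as the rank of the
  incidence matrix. The form with monomials fits the toric map directly and does not depend on the
  characteristic of \<open>K\<close>.\<close>

definition toric_indep :: "'v set set \<Rightarrow> bool" where
  "toric_indep F \<longleftrightarrow> (\<forall>\<alpha> \<beta>. supp \<alpha> \<subseteq> F \<longrightarrow> supp \<beta> \<subseteq> F \<longrightarrow>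
     edge_mono_image \<alpha> = edge_mono_image \<beta> \<longrightarrow> \<alpha> = \<beta>)"

text \<open>For a chain of primes \<open>P\<^sub>0 \<subset> \<dots> \<subset> P\<^sub>n\<close> ending in the toric ideal, any choice of
  \<open>f\<^sub>i \<in> P\<^sub>i - P\<^sub>i\<^sub>-\<^sub>1\<close> is algebraically independent together with the edges in \<open>F\<close>.\<close>

lemma chain_indep_mod:
  fixes c :: "nat \<Rightarrow> (('v set \<Rightarrow>\<^sub>0 nat) \<Rightarrow>\<^sub>0 'k::field) set"
  assumes fin: "finite E" and F: "F \<subseteq> E" "toric_indep F"
    and c: "\<forall>i\<le>n. prime_ideal_in (edge_ring E) (c i)" "\<forall>i<n. c i \<subset> c (Suc i)"
      "c n = toric_ideal E"
  shows "k \<le> n \<Longrightarrow> \<exists>C. \<forall>d. \<exists>U. U \<subseteq> edge_ring E \<and> indep_mod (c (n - k)) U id \<and>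
     card U = (d + 1) ^ (card F + k) \<and> (\<forall>u\<in>U. exponents_le (C * d) u)"
proof (induction k)
  case 0
  have finF: "finite F" using fin F finite_subset by blast
  show ?case
  proof (rule exI[of _ 1], intro allI)
    fix d
    let ?g = "\<lambda>\<beta>. monom \<beta> 1 :: ('v set \<Rightarrow>\<^sub>0 nat) \<Rightarrow>\<^sub>0 'k"
    let ?J = "box_monomials F d"
    \<comment> \<open>At the top of the chain the family consists of the monomials in
      \<open>F\<close> with exponents up to \<open>d\<close>; the toric map sends them to distinct
      monomials.\<close>
    have "indep_mod (toric_ideal E) ?J ?g"
      unfolding indep_mod_def
    proof (intro conjI allI impI ballI)
      show "finite ?J" using card_box_monomials finF by blast
      fix a \<beta> assume "(\<Sum>i\<in>?J. monom 0 (a i) * ?g i) \<in> toric_ideal E" and \<beta>: "\<beta> \<in> ?J"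
      then have "toric_map (\<Sum>i\<in>?J. monom 0 (a i) * ?g i) = 0" by (simp add: toric_ideal_def)
      then have "(\<Sum>i\<in>?J. if edge_mono_image i = edge_mono_image \<beta> then a i else 0) = 0"
        by (simp add: mult_single toric_map_sum poly_mapping_eq_iff lookup_sum lookup_single
            when_def fun_eq_iff)
      also have "(\<Sum>i\<in>?J. if edge_mono_image i = edge_mono_image \<beta> then a i else 0)
          = (\<Sum>i\<in>?J. if i = \<beta> then a i else 0)"
        using F(2) \<beta> by (intro sum.cong refl) (auto simp: toric_indep_def box_monomials_def)
      also have "\<dots> = a \<beta>" using \<beta> \<open>finite ?J\<close> by simp
      finally show "a \<beta> = 0" .
    qed
    note * = indep_mod_image[OF this]
    have z: "0 \<in> toric_ideal E" by (simp add: toric_ideal_def edge_ring_zero)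
    show "\<exists>U. U \<subseteq> edge_ring E \<and> indep_mod (c (n - 0)) U id \<and>
     card U = (d + 1) ^ (card F + 0) \<and> (\<forall>u\<in>U. exponents_le (1 * d) u)"
      using *[OF z] F(1) card_box_monomials(2)[OF finF, of d] c(3)
      by (intro exI[of _ "?g ` ?J"])
        (auto simp: exponents_le_def box_monomials_def intro!: edge_ring_monom)
  qed
next
  case (Suc k)
  then obtain C where C: "\<And>d. \<exists>U. U \<subseteq> edge_ring E \<and> indep_mod (c (n - k)) U id \<and>
     card U = (d + 1) ^ (card F + k) \<and> (\<forall>u\<in>U. exponents_le (C * d) u)"
    using Suc_leD by blast
  have nk: "n - k = Suc (n - Suc k)" using Suc.prems by simp
  have P: "prime_ideal_in (edge_ring E) (c (n - Suc k))" using c(1) by simp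
  have Q: "ideal_in (edge_ring E) (c (n - k))" using c(1) by (simp add: prime_ideal_in_def)
  have sub: "c (n - Suc k) \<subset> c (n - k)" unfolding nk using c(2) Suc.prems by simp
  then obtain f where f: "f \<in> c (n - k)" "f \<notin> c (n - Suc k)" by blast
  have fR: "f \<in> edge_ring E" using f Q by (auto simp: ideal_in_def)
  have z: "0 \<in> c (n - Suc k)" using P by (simp add: prime_ideal_in_def ideal_in_def)
  obtain N where N: "exponents_le N f" using exponents_le_exists by blast
  show ?case
  \<comment> \<open>For \<open>j <= d\<close> the power \<open>f ^ j\<close> has exponents at most
    \<open>N * d\<close>, and \<open>u\<close> has exponents at most \<open>C * d\<close>. The
    constant must not depend on \<open>d\<close>, since \<open>d\<close> is chosen in terms of it
    later.\<close>
  proof (rule exI[of _ "N + C"], intro allI)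
    fix d
    obtain U where U: "U \<subseteq> edge_ring E" "indep_mod (c (n - k)) U id"
      "card U = (d + 1) ^ (card F + k)" "\<forall>u\<in>U. exponents_le (C * d) u" using C by blast
    have "c (n - Suc k) \<subseteq> c (n - k)" using sub by blast
    note * = indep_mod_image[OF indep_mod_powers[OF P Q this f U(1,2), of d] z]
    let ?U = "(\<lambda>(j, u). f ^ j * u) ` ({..d} \<times> U)"
    have "exponents_le ((N + C) * d) (f ^ j * u)" if "j \<le> d" "u \<in> U" for j u
    proof (rule exponents_le_mono[OF exponents_le_mult[OF exponents_le_power[OF N]]])
      show "exponents_le (C * d) u" using U that by auto
      show "j * N + C * d \<le> (N + C) * d" using that by (simp add: algebra_simps)
    qed
    moreover have "?U \<subseteq> edge_ring E" using U(1) fR by (auto intro!: edge_ring_mult edge_ring_power)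
    moreover have "card ?U = (d + 1) ^ (card F + Suc k)"
      using *(2) U(3) by (simp add: card_cartesian_product)
    ultimately show "\<exists>U. U \<subseteq> edge_ring E \<and> indep_mod (c (n - Suc k)) U id \<and>
     card U = (d + 1) ^ (card F + Suc k) \<and> (\<forall>u\<in>U. exponents_le ((N + C) * d) u)"
      using *(1) by (intro exI[of _ ?U]) auto
  qed
qed

text \<open>The independent family at the bottom of the chain has
  \<open>(d + 1) ^ (card F + n)\<close> elements, but fits into a box with
  \<open>(C * d + 1) ^ card E\<close> monomials. For large \<open>d\<close> the first exponent
  cannot exceed the second.\<close>

lemma chain_length_le:
  fixes c :: "nat \<Rightarrow> (('v set \<Rightarrow>\<^sub>0 nat) \<Rightarrow>\<^sub>0 'k::field) set"
  assumes "finite E" "F \<subseteq> E" "toric_indep F"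
    and c: "\<forall>i\<le>n. prime_ideal_in (edge_ring E) (c i)" "\<forall>i<n. c i \<subset> c (Suc i)"
      "c n = toric_ideal E"
  shows "n + card F \<le> card E"
proof (rule ccontr)
  assume "\<not> ?thesis"
  then have gt: "Suc (card E) \<le> card F + n" by simp
  obtain C where C: "\<And>d. \<exists>U. U \<subseteq> edge_ring E \<and> indep_mod (c 0) U id \<and>
     card U = (d + 1) ^ (card F + n) \<and> (\<forall>u\<in>U. exponents_le (C * d) u)"
    using chain_indep_mod[OF assms, of n] by auto
  have z: "0 \<in> c 0" using c by (auto simp: prime_ideal_in_def ideal_in_def)
  \<comment> \<open>With this \<open>d\<close> the box has at most
    \<open>(C + 1) ^ card E * (d + 1) ^ card E = d * (d + 1) ^ card E\<close> monomials, which is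
    less than \<open>(d + 1) ^ Suc (card E)\<close>.\<close>
  define d where "d = (C + 1) ^ card E"
  obtain U where U: "U \<subseteq> edge_ring E" "indep_mod (c 0) U id"
     "card U = (d + 1) ^ (card F + n)" "\<forall>u\<in>U. exponents_le (C * d) u" using C by blast
  have "(d + 1) * (d + 1) ^ card E \<le> (d + 1) ^ (card F + n)"
    using power_increasing[OF gt, of "d + 1"] by simp
  also have "\<dots> \<le> (C * d + 1) ^ card E"
    using indep_mod_card_le[OF assms(1) U(1,2) z, of "C * d"] U by simp
  also have "\<dots> \<le> ((C + 1) * (d + 1)) ^ card E" by (rule power_mono) (auto simp: algebra_simps)
  also have "\<dots> = d * (d + 1) ^ card E" by (simp only: power_mult_distrib d_def)
  finally show False by simp
qed

lemma toric_ideal_height_le: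
  assumes "finite E" "F \<subseteq> E" "toric_indep F"
  shows "ideal_height (edge_ring E) (toric_ideal E :: (('v set \<Rightarrow>\<^sub>0 nat) \<Rightarrow>\<^sub>0 'k::field) set)
    \<le> enat (card E - card F)"
proof -
  let ?I = "toric_ideal E :: (('v set \<Rightarrow>\<^sub>0 nat) \<Rightarrow>\<^sub>0 'k) set"
  have "ideal_height (edge_ring E) ?I \<le> prime_height (edge_ring E) ?I"
    unfolding ideal_height_def using toric_ideal_prime by (intro Inf_lower) auto
  also have "\<dots> \<le> enat (card E - card F)"
    unfolding prime_height_def
  proof (rule Sup_least, clarify)
    fix n and c :: "nat \<Rightarrow> (('v set \<Rightarrow>\<^sub>0 nat) \<Rightarrow>\<^sub>0 'k) set"
    assume "\<forall>i\<le>n. prime_ideal_in (edge_ring E) (c i)" "\<forall>i<n. c i \<subset> c (Suc i)" "c n = ?I"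
    from chain_length_le[OF assms this] show "enat n \<le> enat (card E - card F)" by simp
  qed
  finally show ?thesis .
qed

section \<open>Relations among edges\<close>

text \<open>Integer relations among the incidence vectors of the edges inside \<open>W\<close>, i.e. the lattice of
  the toric ideal of the induced subgraph on \<open>W\<close>.\<close>

definition balanced :: "'v set set \<Rightarrow> 'v set \<Rightarrow> ('v set \<Rightarrow> int) \<Rightarrow> bool" where
  "balanced E W z \<longleftrightarrow> (\<forall>e. z e \<noteq> 0 \<longrightarrow> e \<in> E \<and> e \<subseteq> W) \<and>
     (\<forall>v. (\<Sum>e | e \<in> E \<and> v \<in> e. z e) = 0)"

text \<open>The exponent pairs of the binomials in the toric ideal; \<open>diff_vec\<close> turns
  them into lattice vectors.\<close>

definition fiber_pairs :: "'v set set \<Rightarrow> (('v set \<Rightarrow>\<^sub>0 nat) \<times> ('v set \<Rightarrow>\<^sub>0 nat)) set" where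
  "fiber_pairs E = {(\<alpha>, \<beta>). supp \<alpha> \<subseteq> E \<and> supp \<beta> \<subseteq> E \<and> edge_mono_image \<alpha> = edge_mono_image \<beta>}"

definition diff_vec :: "('x \<Rightarrow>\<^sub>0 nat) \<times> ('x \<Rightarrow>\<^sub>0 nat) \<Rightarrow> 'x \<Rightarrow> int" where
  "diff_vec t e = int (coef (fst t) e) - int (coef (snd t) e)"

definition int_span :: "('x \<Rightarrow> int) set \<Rightarrow> ('x \<Rightarrow> int) set" where
  "int_span S = {z. \<exists>k. \<forall>e. z e = (\<Sum>t\<in>S. k t * t e)}"

lemma int_span_base:
  assumes "finite S" "t \<in> S"
  shows "t \<in> int_span S"
proof -
  have "t e = (\<Sum>s\<in>S. (if s = t then 1 else 0) * s e)" for e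
    using assms by (simp add: if_distrib[of "\<lambda>x. x * _"] cong: if_cong)
  then show ?thesis unfolding int_span_def by (intro CollectI exI[of _ "\<lambda>s. if s = t then 1 else 0"]) simp
qed

lemma int_span_zero: "(\<lambda>e. 0) \<in> int_span S"
  unfolding int_span_def by (intro CollectI exI[of _ "\<lambda>s. 0"]) simp

lemma int_span_diff:
  assumes "x \<in> int_span S" "y \<in> int_span S"
  shows "(\<lambda>e. x e - y e) \<in> int_span S"
proof -
  obtain k where k: "\<forall>e. x e = (\<Sum>t\<in>S. k t * t e)" using assms(1) by (auto simp: int_span_def)
  obtain l where l: "\<forall>e. y e = (\<Sum>t\<in>S. l t * t e)" using assms(2) by (auto simp: int_span_def)
  show ?thesis
    unfolding int_span_def using k l
    by (intro CollectI exI[of _ "\<lambda>t. k t - l t"]) (simp add: left_diff_distrib sum_subtractf)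
qed

lemma simple_graph_finite_edges: "simple_graph V E \<Longrightarrow> finite E"
  unfolding simple_graph_def by (rule finite_subset[of _ "Pow V"]) auto

lemma simple_graph_edge:
  assumes "simple_graph V E" "e \<in> E"
  shows "finite e" "e \<subseteq> V" "\<exists>u v. u \<noteq> v \<and> e = {u, v}"
  using assms card_2_iff[of e] by (auto simp: simple_graph_def intro: finite_subset)

lemma coef_image_graph:
  assumes "simple_graph V E" "supp \<alpha> \<subseteq> E"
  shows "coef (edge_mono_image \<alpha>) v = (\<Sum>e | e \<in> E \<and> v \<in> e. coef \<alpha> e)"
  using coef_edge_mono_image[OF simple_graph_finite_edges[OF assms(1)] assms(2)]
    simple_graph_edge(1)[OF assms(1)] by blast

lemma coef_image_pos_iff:
  assumes "simple_graph V E" "supp \<alpha> \<subseteq> E"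
  shows "coef (edge_mono_image \<alpha>) v \<noteq> 0 \<longleftrightarrow> (\<exists>e\<in>supp \<alpha>. v \<in> e)"
  using assms(2) simple_graph_finite_edges[OF assms(1)]
  by (auto simp: coef_image_graph[OF assms] in_keys_iff)

text \<open>The image of a monomial has positive degree at exactly the vertices covered by its
  edges, so the image determines the covered vertices. This is why relations can be localised to
  induced subgraphs.\<close>

lemma supp_fiber:
  assumes "simple_graph V E" "supp \<alpha> \<subseteq> E" "supp \<delta> \<subseteq> E"
    and "edge_mono_image \<delta> = edge_mono_image \<alpha>" "\<And>e. e \<in> supp \<alpha> \<Longrightarrow> e \<subseteq> W" "e \<in> supp \<delta>"
  shows "e \<subseteq> W"
proof
  fix v assume "v \<in> e"
  then have "coef (edge_mono_image \<alpha>) v \<noteq> 0"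
    using assms(6) coef_image_pos_iff[OF assms(1,3)] unfolding assms(4) by blast
  then show "v \<in> W" using coef_image_pos_iff[OF assms(1,2)] assms(5) by blast
qed

lemma balanced_diff_vec:
  assumes "simple_graph V E" "t \<in> fiber_pairs E"
    and W: "\<And>e. e \<in> supp (fst t) \<Longrightarrow> e \<subseteq> W"
  shows "balanced E W (diff_vec t)"
proof -
  obtain \<alpha> \<beta> where t: "t = (\<alpha>, \<beta>)" "supp \<alpha> \<subseteq> E" "supp \<beta> \<subseteq> E"
    "edge_mono_image \<alpha> = edge_mono_image \<beta>"
    using assms(2) by (auto simp: fiber_pairs_def)
  have "e \<subseteq> W" if "e \<in> supp \<beta>" for e
    using supp_fiber[OF assms(1) t(2,3) t(4)[symmetric] _ that, of W] W t(1) by auto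
  moreover have "(\<Sum>e | e \<in> E \<and> v \<in> e. diff_vec t e) = 0" for v
  proof -
    have "(\<Sum>e | e \<in> E \<and> v \<in> e. coef \<alpha> e) = (\<Sum>e | e \<in> E \<and> v \<in> e. coef \<beta> e)"
      using coef_image_graph[OF assms(1) t(2), of v] coef_image_graph[OF assms(1) t(3), of v] t(4)
      by simp
    then show ?thesis by (simp add: t(1) diff_vec_def sum_subtractf flip: of_nat_sum)
  qed
  moreover have "diff_vec t e \<noteq> 0 \<Longrightarrow> e \<in> supp \<alpha> \<or> e \<in> supp \<beta>" for e
    by (auto simp: t(1) diff_vec_def in_keys_iff)
  moreover have "e \<subseteq> W" if "e \<in> supp \<alpha>" for e using W t(1) that by simp
  ultimately show ?thesis using t(2,3) unfolding balanced_def by blast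
qed

text \<open>The two exponents are the positive and the negative part of \<open>z\<close>;
  \<open>nat\<close> cuts off the other sign.\<close>

lemma balanced_eq_diff_vec:
  assumes "simple_graph V E" "balanced E W z"
  shows "\<exists>\<alpha> \<beta>. (\<alpha>, \<beta>) \<in> fiber_pairs E \<and> (\<forall>e\<in>supp \<alpha>. e \<subseteq> W) \<and> z = diff_vec (\<alpha>, \<beta>)"
proof -
  have "finite {e. z e \<noteq> 0}"
    using assms by (intro finite_subset[OF _ simple_graph_finite_edges[OF assms(1)]])
      (auto simp: balanced_def)
  then have "finite {e. nat (z e) \<noteq> 0}" "finite {e. nat (- z e) \<noteq> 0}"
    by (auto elim: rev_finite_subset)
  then have co: "coef (Abs_poly_mapping (\<lambda>e. nat (z e))) e = nat (z e)"
    "coef (Abs_poly_mapping (\<lambda>e. nat (- z e))) e = nat (- z e)" for e by auto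
  define \<alpha> where "\<alpha> = Abs_poly_mapping (\<lambda>e. nat (z e))"
  define \<beta> where "\<beta> = Abs_poly_mapping (\<lambda>e. nat (- z e))"
  note co = co[folded \<alpha>_def \<beta>_def]
  have z: "z = diff_vec (\<alpha>, \<beta>)" by (auto simp: diff_vec_def co)
  have s: "supp \<alpha> \<subseteq> E" "supp \<beta> \<subseteq> E" "\<forall>e\<in>supp \<alpha>. e \<subseteq> W"
    using assms(2) by (auto simp: balanced_def in_keys_iff co)
  have "edge_mono_image \<alpha> = edge_mono_image \<beta>"
  proof (rule poly_mapping_eqI)
    fix v
    have "(\<Sum>e | e \<in> E \<and> v \<in> e. diff_vec (\<alpha>, \<beta>) e) = 0"
      using assms(2) z by (simp add: balanced_def)
    then have "int (\<Sum>e | e \<in> E \<and> v \<in> e. coef \<alpha> e) = int (\<Sum>e | e \<in> E \<and> v \<in> e. coef \<beta> e)"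
      by (simp add: diff_vec_def sum_subtractf)
    then show "coef (edge_mono_image \<alpha>) v = coef (edge_mono_image \<beta>) v"
      using coef_image_graph[OF assms(1)] s(1,2) by (metis of_nat_eq_iff)
  qed
  then show ?thesis using s z by (auto simp: fiber_pairs_def)
qed

section \<open>Minimal binomial generators of a complete intersection\<close>

text \<open>The functionals induced by these functions are exactly those that vanish on
  \<open>\<mm> I\<close>, where \<open>I\<close> is the toric ideal and \<open>\<mm>\<close> the maximal ideal of the origin.\<close>

definition minimal_functional :: "'v set set \<Rightarrow> (('v set \<Rightarrow>\<^sub>0 nat) \<Rightarrow> 'k) \<Rightarrow> bool" where
  "minimal_functional E \<phi> \<longleftrightarrow> (\<forall>\<gamma> \<alpha> \<beta>. \<gamma> \<noteq> 0 \<longrightarrow> supp \<gamma> \<subseteq> E \<longrightarrow> (\<alpha>, \<beta>) \<in> fiber_pairs E \<longrightarrow>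
     \<phi> (\<gamma> + \<alpha>) = \<phi> (\<gamma> + \<beta>))"

text \<open>Modulo \<open>\<mm>I\<close> the product \<open>r * g\<close> equals the constant term
  of \<open>r\<close> times \<open>g\<close>: each nonconstant monomial of \<open>r\<close>
  contributes a functional that is constant on fibers and hence 0 on \<open>g\<close>.\<close>

lemma lin_minimal_functional:
  fixes r g :: "('v set \<Rightarrow>\<^sub>0 nat) \<Rightarrow>\<^sub>0 'k::field"
  assumes "minimal_functional E \<phi>" "r \<in> edge_ring E" "g \<in> toric_ideal E"
  shows "lin \<phi> (r * g) = coef r 0 * lin \<phi> g"
proof -
  have "lin (\<lambda>\<beta>. \<phi> (\<gamma> + \<beta>)) g = 0" if "\<gamma> \<in> supp r" "\<gamma> \<noteq> 0" for \<gamma>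
  proof (rule lin_toric_ideal[OF assms(3)])
    fix \<alpha> \<beta> assume "supp \<alpha> \<subseteq> E" "supp \<beta> \<subseteq> E" "edge_mono_image \<alpha> = edge_mono_image \<beta>"
    then have "(\<alpha>, \<beta>) \<in> fiber_pairs E" by (simp add: fiber_pairs_def)
    moreover have "supp \<gamma> \<subseteq> E" using assms(2) that by (simp add: edge_ring_def)
    ultimately show "\<phi> (\<gamma> + \<alpha>) = \<phi> (\<gamma> + \<beta>)"
      using assms(1) that(2) unfolding minimal_functional_def by blast
  qed
  then have "coef r \<gamma> * lin (\<lambda>\<beta>. \<phi> (\<gamma> + \<beta>)) g = (if \<gamma> = 0 then coef r 0 * lin \<phi> g else 0)"
    if "\<gamma> \<in> supp r" for \<gamma> using that by simp
  then show ?thesis by (simp add: lin_mult in_keys_iff)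
qed

text \<open>The binomials of \<open>T\<close> are linearly independent in \<open>I / \<mm>I\<close>.
  Testing against functionals takes the place of the quotient space.\<close>

definition minimal_pairs ::
  "'k::field itself \<Rightarrow> 'v set set \<Rightarrow> (('v set \<Rightarrow>\<^sub>0 nat) \<times> ('v set \<Rightarrow>\<^sub>0 nat)) set \<Rightarrow> bool" where
  "minimal_pairs _ E T \<longleftrightarrow> finite T \<and> T \<subseteq> fiber_pairs E \<and>
     (\<forall>c :: _ \<Rightarrow> 'k. (\<forall>\<phi>. minimal_functional E \<phi> \<longrightarrow> (\<Sum>t\<in>T. c t * (\<phi> (fst t) - \<phi> (snd t))) = 0)
        \<longrightarrow> (\<forall>t\<in>T. c t = 0))"

lemma ideal_gen_nth:
  assumes "i < length gs"
  shows "gs ! i \<in> ideal_gen (edge_ring E) gs"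
proof -
  have "(\<Sum>j<length gs. (if j = i then 1 else 0) * gs ! j) = gs ! i"
    using assms by (simp add: if_distrib[of "\<lambda>x. x * _"] cong: if_cong)
  moreover have "\<forall>j. (if j = i then 1 else 0) \<in> edge_ring E" by (simp add: edge_ring_one edge_ring_zero)
  ultimately show ?thesis unfolding ideal_gen_def
    by (intro CollectI exI[of _ "\<lambda>j. if j = i then 1 else 0"]) simp
qed

text \<open>Each binomial is a combination of the generators, and in \<open>I / \<mm>I\<close> only
  the constant terms of its coefficients count. So the classes of the generators span a space
  containing \<open>card T\<close> independent classes.\<close>

lemma minimal_pairs_card_le:
  fixes gs :: "(('v set \<Rightarrow>\<^sub>0 nat) \<Rightarrow>\<^sub>0 'k::field) list"
  assumes T: "minimal_pairs TYPE('k) E T" and gs: "toric_ideal E = ideal_gen (edge_ring E) gs"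
  shows "card T \<le> length gs"
proof (rule ccontr)
  assume "\<not> ?thesis"
  then have lt: "card {..<length gs} < card T" by simp
  have "\<exists>r. (\<forall>i. r i \<in> edge_ring E) \<and>
      monom (fst t) 1 - monom (snd t) (1 :: 'k) = (\<Sum>i<length gs. r i * gs ! i)" if "t \<in> T" for t
  proof -
    have "t \<in> fiber_pairs E" using T that by (auto simp: minimal_pairs_def)
    then have "monom (fst t) 1 - monom (snd t) (1 :: 'k) \<in> toric_ideal E"
      by (auto simp: fiber_pairs_def toric_ideal_def toric_map_diff
          intro!: edge_ring_diff edge_ring_monom)
    then show ?thesis unfolding gs ideal_gen_def by auto
  qed
  then have "\<forall>t\<in>T. \<exists>r. (\<forall>i. r i \<in> edge_ring E) \<and>
      monom (fst t) 1 - monom (snd t) (1 :: 'k) = (\<Sum>i<length gs. r i * gs ! i)" by blast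
  from bchoice[OF this] obtain r where r: "\<And>t i. t \<in> T \<Longrightarrow> r t i \<in> edge_ring E"
    "\<And>t. t \<in> T \<Longrightarrow> monom (fst t) 1 - monom (snd t) (1 :: 'k) = (\<Sum>i<length gs. r t i * gs ! i)"
    by blast
  have "finite T" using T by (simp add: minimal_pairs_def)
  from exists_nontrivial_relation[OF _ this lt, of "\<lambda>t i. coef (r t i) 0"] obtain c where
    c: "\<exists>t\<in>T. c t \<noteq> 0" "\<forall>i<length gs. (\<Sum>t\<in>T. c t * coef (r t i) 0) = 0" by auto
  have "(\<Sum>t\<in>T. c t * (\<phi> (fst t) - \<phi> (snd t))) = 0" if \<phi>: "minimal_functional E \<phi>" for \<phi>
  proof -
    have "\<phi> (fst t) - \<phi> (snd t) = (\<Sum>i<length gs. coef (r t i) 0 * lin \<phi> (gs ! i))" if "t \<in> T" for t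
    proof -
      have "\<phi> (fst t) - \<phi> (snd t) = lin \<phi> (\<Sum>i<length gs. r t i * gs ! i)"
        using r(2)[OF that, symmetric] by (simp add: lin_diff)
      also have "\<dots> = (\<Sum>i<length gs. coef (r t i) 0 * lin \<phi> (gs ! i))"
        unfolding lin_sum using r(1)[OF that] ideal_gen_nth[of _ gs E] gs \<phi>
        by (intro sum.cong refl lin_minimal_functional) auto
      finally show ?thesis .
    qed
    then have "(\<Sum>t\<in>T. c t * (\<phi> (fst t) - \<phi> (snd t)))
        = (\<Sum>t\<in>T. \<Sum>i<length gs. c t * coef (r t i) 0 * lin \<phi> (gs ! i))"
      by (simp add: sum_distrib_left mult.assoc)
    also have "\<dots> = (\<Sum>i<length gs. (\<Sum>t\<in>T. c t * coef (r t i) 0) * lin \<phi> (gs ! i))"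
      by (subst sum.swap) (simp add: sum_distrib_right)
    also have "\<dots> = 0" using c(2) by simp
    finally show ?thesis .
  qed
  then show False using T c(1) unfolding minimal_pairs_def by blast
qed

lemma supp_add_nat:
  fixes \<gamma> \<alpha> :: "'x \<Rightarrow>\<^sub>0 nat"
  shows "supp (\<gamma> + \<alpha>) = supp \<gamma> \<union> supp \<alpha>"
  by (auto simp: in_keys_iff lookup_add)

text \<open>A graded Nakayama argument by induction on the vertex degree of the fiber. Maximality of
  \<open>T\<close> gives dependence over \<open>K\<close> only; an integral conclusion results from
  testing this dependence on the indicator function of a set defined by the integer span.\<close>

lemma minimal_pairs_span:
  fixes V :: "'v set"
  assumes G: "simple_graph V E" and T: "minimal_pairs TYPE('k::field) E T"
    and max: "\<And>T'. minimal_pairs TYPE('k) E T' \<Longrightarrow> card T' \<le> card T"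
    and "(\<alpha>, \<beta>) \<in> fiber_pairs E" "\<And>e. e \<in> supp \<alpha> \<Longrightarrow> e \<subseteq> W"
  shows "diff_vec (\<alpha>, \<beta>) \<in> int_span {t \<in> diff_vec ` T. balanced E W t}"
  using assms(4,5)
proof (induction "\<Sum>v\<in>V. coef (edge_mono_image \<alpha>) v" arbitrary: \<alpha> \<beta> rule: less_induct)
  case less
  let ?S = "{t \<in> diff_vec ` T. balanced E W t}"
  have finT: "finite T" and TE: "T \<subseteq> fiber_pairs E" using T by (auto simp: minimal_pairs_def)
  have finS: "finite ?S" using finT by simp
  have \<alpha>E: "supp \<alpha> \<subseteq> E" and \<beta>E: "supp \<beta> \<subseteq> E"
    and ab: "edge_mono_image \<alpha> = edge_mono_image \<beta>"
    using less.prems(1) by (auto simp: fiber_pairs_def)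
  \<comment> \<open>\<open>C\<close> is the part of the fiber of \<open>\<alpha>\<close> that is
    reachable from \<open>\<alpha>\<close> modulo the span; the goal is that \<open>\<beta>\<close>
    lies in it.\<close>
  define C where "C = {\<delta>. supp \<delta> \<subseteq> E \<and> edge_mono_image \<delta> = edge_mono_image \<alpha> \<and>
    diff_vec (\<delta>, \<alpha>) \<in> int_span ?S}"
  define \<phi> :: "_ \<Rightarrow> 'k" where "\<phi> \<delta> = (if \<delta> \<in> C then 1 else 0)" for \<delta>
  have suppW: "e \<subseteq> W" if "supp \<delta> \<subseteq> E" "edge_mono_image \<delta> = edge_mono_image \<alpha>" "e \<in> supp \<delta>" for \<delta> e
    using supp_fiber[OF G \<alpha>E that(1,2) less.prems(2) that(3)] .
  \<comment> \<open>After removal of the common factor \<open>\<gamma>\<close> the pair lies in a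
    fiber of smaller degree, so the induction hypothesis applies. Hence the indicator of
    \<open>C\<close> vanishes on \<open>\<mm>I\<close>.\<close>
  have move: "\<gamma> + \<beta>' \<in> C"
    if C: "\<gamma> + \<alpha>' \<in> C" and \<gamma>: "\<gamma> \<noteq> 0" "supp \<gamma> \<subseteq> E" and pair: "(\<alpha>', \<beta>') \<in> fiber_pairs E"
    for \<gamma> \<alpha>' \<beta>' :: "'v set \<Rightarrow>\<^sub>0 nat"
  proof -
    have im: "edge_mono_image \<gamma> + edge_mono_image \<alpha>' = edge_mono_image \<alpha>"
      using C by (simp add: C_def edge_mono_image_add)
    have "supp (\<gamma> + \<alpha>') \<subseteq> E" using C by (simp add: C_def)
    then have W: "\<And>e. e \<in> supp \<alpha>' \<Longrightarrow> e \<subseteq> W"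
      using suppW[of "\<gamma> + \<alpha>'"] im by (auto simp: supp_add_nat edge_mono_image_add)
    obtain e where e: "e \<in> supp \<gamma>" using \<gamma>(1) by (metis ex_in_conv keys_eq_empty)
    then obtain v where v: "v \<in> e" "v \<in> V" using simple_graph_edge[OF G, of e] \<gamma>(2) by blast
    have "0 < coef (edge_mono_image \<gamma>) v"
      using coef_image_pos_iff[OF G \<gamma>(2), of v] e v by blast
    also have "\<dots> \<le> (\<Sum>v\<in>V. coef (edge_mono_image \<gamma>) v)"
      using v G by (intro member_le_sum) (auto simp: simple_graph_def)
    finally have "(\<Sum>v\<in>V. coef (edge_mono_image \<alpha>') v) < (\<Sum>v\<in>V. coef (edge_mono_image \<alpha>) v)"
      by (simp add: im[symmetric] lookup_add sum.distrib)
    from less.hyps[OF this pair W] have "diff_vec (\<alpha>', \<beta>') \<in> int_span ?S" .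
    moreover have "diff_vec (\<gamma> + \<alpha>', \<alpha>) \<in> int_span ?S" using C by (simp add: C_def)
    ultimately have "(\<lambda>e. diff_vec (\<gamma> + \<alpha>', \<alpha>) e - diff_vec (\<alpha>', \<beta>') e) \<in> int_span ?S"
      by (intro int_span_diff)
    moreover have "(\<lambda>e. diff_vec (\<gamma> + \<alpha>', \<alpha>) e - diff_vec (\<alpha>', \<beta>') e) = diff_vec (\<gamma> + \<beta>', \<alpha>)"
      by (auto simp: diff_vec_def lookup_add)
    ultimately show ?thesis
      using C pair by (auto simp: C_def fiber_pairs_def supp_add_nat edge_mono_image_add)
  qed
  have min: "minimal_functional E \<phi>"
    unfolding minimal_functional_def
  proof (intro allI impI)
    fix \<gamma> \<alpha>' \<beta>' :: "'v set \<Rightarrow>\<^sub>0 nat" assume *: "\<gamma> \<noteq> 0" "supp \<gamma> \<subseteq> E" "(\<alpha>', \<beta>') \<in> fiber_pairs E"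
    then have "(\<beta>', \<alpha>') \<in> fiber_pairs E" by (auto simp: fiber_pairs_def)
    then show "\<phi> (\<gamma> + \<alpha>') = \<phi> (\<gamma> + \<beta>')" using move[OF _ *] move[OF _ *(1,2)] by (auto simp: \<phi>_def)
  qed
  have \<phi>T: "\<phi> (fst t) - \<phi> (snd t) = 0" if t: "t \<in> T" for t
  proof (cases "edge_mono_image (fst t) = edge_mono_image \<alpha>")
    case True
    have tE: "t \<in> fiber_pairs E" using t TE by auto
    then have "supp (fst t) \<subseteq> E" by (auto simp: fiber_pairs_def)
    then have "\<And>e. e \<in> supp (fst t) \<Longrightarrow> e \<subseteq> W" using suppW[OF _ True] by blast
    then have "diff_vec t \<in> ?S" using balanced_diff_vec[OF G tE] t by auto
    then have st: "diff_vec t \<in> int_span ?S" using int_span_base[OF finS] by blast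
    have neg: "(\<lambda>e. 0 - diff_vec t e) \<in> int_span ?S"
      by (rule int_span_diff[OF int_span_zero st])
    have "diff_vec (fst t, \<alpha>) \<in> int_span ?S \<longleftrightarrow> diff_vec (snd t, \<alpha>) \<in> int_span ?S"
    proof
      assume "diff_vec (fst t, \<alpha>) \<in> int_span ?S"
      from int_span_diff[OF this st] show "diff_vec (snd t, \<alpha>) \<in> int_span ?S"
        by (simp add: diff_vec_def[abs_def])
    next
      assume "diff_vec (snd t, \<alpha>) \<in> int_span ?S"
      from int_span_diff[OF this neg] show "diff_vec (fst t, \<alpha>) \<in> int_span ?S"
        by (simp add: diff_vec_def[abs_def])
    qed
    then show ?thesis using tE by (auto simp: \<phi>_def C_def fiber_pairs_def)
  next
    case False
    then show ?thesis using t TE by (auto simp: \<phi>_def C_def fiber_pairs_def)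
  qed
  show ?case
  proof (cases "(\<alpha>, \<beta>) \<in> T")
    case True
    then have "diff_vec (\<alpha>, \<beta>) \<in> ?S" using balanced_diff_vec[OF G less.prems(1), of W] less.prems(2) by auto
    then show ?thesis using int_span_base[OF finS] by blast
  next
    case False
    let ?s = "(\<alpha>, \<beta>)"
    \<comment> \<open>By maximality the class of the new binomial depends on \<open>T\<close>, with
      \<open>c ?s\<close> nonzero since \<open>T\<close> is independent. As \<open>\<phi>\<close>
      vanishes on the binomials of \<open>T\<close>, it takes equal values at
      \<open>\<alpha>\<close> and \<open>\<beta>\<close>.\<close>
    have "\<not> minimal_pairs TYPE('k) E (insert ?s T)"
      using max[of "insert ?s T"] False finT by auto
    then obtain c :: "_ \<Rightarrow> 'k" and t1 where
      c: "\<And>\<phi>. minimal_functional E \<phi> \<Longrightarrow> (\<Sum>t\<in>insert ?s T. c t * (\<phi> (fst t) - \<phi> (snd t))) = 0"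
      and t1: "t1 \<in> insert ?s T" "c t1 \<noteq> 0"
      using finT TE less.prems(1) unfolding minimal_pairs_def by auto
    have "c ?s \<noteq> 0"
    proof
      assume "c ?s = 0"
      then have "\<And>\<phi>. minimal_functional E \<phi> \<Longrightarrow> (\<Sum>t\<in>T. c t * (\<phi> (fst t) - \<phi> (snd t))) = 0"
        using c False finT by simp
      then have "\<forall>t\<in>T. c t = 0" using T unfolding minimal_pairs_def by blast
      then show False using t1 \<open>c ?s = 0\<close> by auto
    qed
    moreover have "c ?s * (\<phi> \<alpha> - \<phi> \<beta>) = 0" using c[OF min] False finT \<phi>T by simp
    moreover have "\<alpha> \<in> C" using \<alpha>E int_span_zero[of ?S] by (simp add: C_def diff_vec_def[abs_def])
    ultimately have "\<beta> \<in> C" by (auto simp: \<phi>_def split: if_splits)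
    then have "diff_vec (\<beta>, \<alpha>) \<in> int_span ?S" by (simp add: C_def)
    from int_span_diff[OF int_span_zero this] show ?thesis by (simp add: diff_vec_def[abs_def])
  qed
qed

section \<open>From minimal binomials to a basis of the lattice of relations\<close>

lemma toric_indep_maximal:
  assumes "finite E"
  obtains F where "F \<subseteq> E" "toric_indep F" "\<And>e. e \<in> E \<Longrightarrow> e \<notin> F \<Longrightarrow> \<not> toric_indep (insert e F)"
proof -
  have "toric_indep {}" by (simp add: toric_indep_def)
  then obtain F where F: "F \<in> {F. F \<subseteq> E \<and> toric_indep F}"
    "\<And>F'. F' \<in> {F. F \<subseteq> E \<and> toric_indep F} \<Longrightarrow> F \<subseteq> F' \<Longrightarrow> F = F'"
    using finite_has_maximal[of "{F. F \<subseteq> E \<and> toric_indep F}"] assms by auto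
  show ?thesis
  proof (rule that[of F])
    fix e assume "e \<in> E" "e \<notin> F"
    then show "\<not> toric_indep (insert e F)" using F(1) F(2)[of "insert e F"] by auto
  qed (use F in auto)
qed

text \<open>If \<open>e\<close> had the same exponent in both monomials, cancelling that power of
  \<open>e\<close> would leave a nontrivial relation inside \<open>F\<close>.\<close>

lemma toric_dependent_relation:
  assumes "toric_indep F" "\<not> toric_indep (insert e F)"
  shows "\<exists>\<alpha> \<beta>. supp \<alpha> \<subseteq> insert e F \<and> supp \<beta> \<subseteq> insert e F \<and>
    edge_mono_image \<alpha> = edge_mono_image \<beta> \<and> coef \<alpha> e \<noteq> coef \<beta> e"
proof -
  obtain \<alpha> \<beta> where ab: "supp \<alpha> \<subseteq> insert e F" "supp \<beta> \<subseteq> insert e F"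
    "edge_mono_image \<alpha> = edge_mono_image \<beta>" "\<alpha> \<noteq> \<beta>"
    using assms(2) by (auto simp: toric_indep_def)
  have "coef \<alpha> e \<noteq> coef \<beta> e"
  proof
    assume eq: "coef \<alpha> e = coef \<beta> e"
    define \<gamma> where "\<gamma> = monom e (coef \<alpha> e)"
    have a: "\<alpha> = (\<alpha> - \<gamma>) + \<gamma>" and b: "\<beta> = (\<beta> - \<gamma>) + \<gamma>"
      using eq by (auto intro!: poly_mapping_eqI simp: \<gamma>_def lookup_add lookup_minus lookup_single when_def)
    have "edge_mono_image (\<alpha> - \<gamma>) = edge_mono_image (\<beta> - \<gamma>)"
      using ab(3) edge_mono_image_add[of "\<alpha> - \<gamma>" \<gamma>] edge_mono_image_add[of "\<beta> - \<gamma>" \<gamma>] a b by simp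
    moreover have "supp (\<alpha> - \<gamma>) \<subseteq> F" "supp (\<beta> - \<gamma>) \<subseteq> F"
    proof -
      have "x \<in> F" if "x \<in> supp (\<delta> - \<gamma>)" "supp \<delta> \<subseteq> insert e F" "coef \<delta> e = coef \<alpha> e" for x \<delta>
      proof (cases "x = e")
        case False
        then have "x \<in> supp \<delta>" using that(1) by (auto simp: in_keys_iff lookup_minus)
        then show ?thesis using that(2) False by auto
      qed (use that in \<open>simp add: \<gamma>_def in_keys_iff lookup_minus\<close>)
      then show "supp (\<alpha> - \<gamma>) \<subseteq> F" "supp (\<beta> - \<gamma>) \<subseteq> F" using ab(1,2) eq by auto
    qed
    ultimately have "\<alpha> - \<gamma> = \<beta> - \<gamma>" using assms(1) by (auto simp: toric_indep_def)
    then show False using a b ab(4) by metis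
  qed
  then show ?thesis using ab by blast
qed

lemma complete_intersection_basis:
  fixes V :: "'v set"
  assumes G: "simple_graph V E" and CI: "graph_complete_intersection TYPE('k::field) E"
  obtains T where "finite T" "\<And>t. t \<in> T \<Longrightarrow> balanced E V t"
    "\<And>k. (\<And>e. (\<Sum>t\<in>T. k t * t e) = 0) \<Longrightarrow> \<forall>t\<in>T. k t = 0"
    "\<And>W z. balanced E W z \<Longrightarrow> z \<in> int_span {t \<in> T. balanced E W t}"
proof -
  have finE: "finite E" by (rule simple_graph_finite_edges[OF G])
  obtain gs :: "(('v set \<Rightarrow>\<^sub>0 nat) \<Rightarrow>\<^sub>0 'k) list" where
    gs: "toric_ideal E = ideal_gen (edge_ring E) gs"
      "enat (length gs) = ideal_height (edge_ring E) (toric_ideal E :: (('v set \<Rightarrow>\<^sub>0 nat) \<Rightarrow>\<^sub>0 'k) set)"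
    using CI unfolding graph_complete_intersection_def complete_intersection_in_def by blast
  have "minimal_pairs TYPE('k) E {}" by (simp add: minimal_pairs_def)
  moreover have "\<forall>T. minimal_pairs TYPE('k) E T \<longrightarrow> card T < Suc (length gs)"
    using minimal_pairs_card_le[OF _ gs(1)] le_imp_less_Suc by blast
  ultimately have "\<exists>T. minimal_pairs TYPE('k) E T \<and>
      (\<forall>T'. minimal_pairs TYPE('k) E T' \<longrightarrow> card T' \<le> card T)"
    by (rule Lattices_Big.ex_has_greatest_nat)
  then obtain T0 where T0: "minimal_pairs TYPE('k) E T0"
    and max: "\<And>T'. minimal_pairs TYPE('k) E T' \<Longrightarrow> card T' \<le> card T0" by blast
  define T where "T = diff_vec ` T0"
  have finT0: "finite T0" and T0E: "T0 \<subseteq> fiber_pairs E" using T0 by (auto simp: minimal_pairs_def)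
  have finT: "finite T" using finT0 by (simp add: T_def)
  have span: "z \<in> int_span {t \<in> T. balanced E W t}" if z: "balanced E W z" for W z
  proof -
    obtain \<alpha> \<beta> where "(\<alpha>, \<beta>) \<in> fiber_pairs E" "\<forall>e\<in>supp \<alpha>. e \<subseteq> W" "z = diff_vec (\<alpha>, \<beta>)"
      using balanced_eq_diff_vec[OF G z] by blast
    then show ?thesis using minimal_pairs_span[OF G T0 max, of \<alpha> \<beta> W] by (simp add: T_def)
  qed
  have bal: "balanced E V t" if t: "t \<in> T" for t
  proof -
    obtain s where s: "s \<in> fiber_pairs E" "t = diff_vec s" using t T0E by (auto simp: T_def)
    then have "supp (fst s) \<subseteq> E" by (auto simp: fiber_pairs_def)
    then show ?thesis using balanced_diff_vec[OF G s(1), of V] simple_graph_edge(2)[OF G] s(2) by blast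
  qed
  obtain F where F: "F \<subseteq> E" "toric_indep F" "\<And>e. e \<in> E \<Longrightarrow> e \<notin> F \<Longrightarrow> \<not> toric_indep (insert e F)"
    using toric_indep_maximal[OF finE] by blast
  \<comment> \<open>Only an inequality, since different pairs may have the same difference
    vector.\<close>
  have "card T \<le> card T0" unfolding T_def by (rule card_image_le[OF finT0])
  also have "\<dots> \<le> length gs" by (rule minimal_pairs_card_le[OF T0 gs(1)])
  also have "\<dots> \<le> card E - card F"
    using toric_ideal_height_le[OF finE F(1,2), where ?'k = 'k] unfolding gs(2)[symmetric] by simp
  also have "\<dots> = card (E - F)" using F(1) finE by (simp add: card_Diff_subset finite_subset)
  finally have cardT: "card T \<le> card (E - F)" .
  \<comment> \<open>The relation expressing the dependence of \<open>e\<close> on \<open>F\<close>.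
    Restricted to \<open>E - F\<close> these relations form a diagonal matrix, so they are
    independent.\<close>
  have "\<exists>z. balanced E V z \<and> z e \<noteq> 0 \<and> (\<forall>e'\<in>E - F. e' \<noteq> e \<longrightarrow> z e' = 0)" if e: "e \<in> E - F" for e
  proof -
    obtain \<alpha> \<beta> where ab: "supp \<alpha> \<subseteq> insert e F" "supp \<beta> \<subseteq> insert e F"
      "edge_mono_image \<alpha> = edge_mono_image \<beta>" "coef \<alpha> e \<noteq> coef \<beta> e"
      using toric_dependent_relation[OF F(2) F(3)] e by blast
    have "(\<alpha>, \<beta>) \<in> fiber_pairs E" using ab e F(1) by (auto simp: fiber_pairs_def)
    then have "balanced E V (diff_vec (\<alpha>, \<beta>))"
      using ab(1) e F(1) simple_graph_edge(2)[OF G] by (intro balanced_diff_vec[OF G]) auto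
    moreover have "diff_vec (\<alpha>, \<beta>) e' = 0" if "e' \<in> E - F" "e' \<noteq> e" for e'
    proof -
      have "e' \<notin> supp \<alpha>" "e' \<notin> supp \<beta>" using ab that by auto
      then show ?thesis by (simp add: diff_vec_def in_keys_iff)
    qed
    ultimately show ?thesis using ab(4) by (intro exI[of _ "diff_vec (\<alpha>, \<beta>)"]) (auto simp: diff_vec_def)
  qed
  then have "\<forall>e\<in>E - F. \<exists>z. balanced E V z \<and> z e \<noteq> 0 \<and> (\<forall>e'\<in>E - F. e' \<noteq> e \<longrightarrow> z e' = 0)"
    by blast
  from bchoice[OF this] obtain z where
    z0: "\<forall>e\<in>E - F. balanced E V (z e) \<and> z e e \<noteq> 0 \<and> (\<forall>e'\<in>E - F. e' \<noteq> e \<longrightarrow> z e e' = 0)" ..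
  have z: "\<And>e. e \<in> E - F \<Longrightarrow> balanced E V (z e)" "\<And>e. e \<in> E - F \<Longrightarrow> z e e \<noteq> 0"
    "\<And>e e'. e \<in> E - F \<Longrightarrow> e' \<in> E - F \<Longrightarrow> e' \<noteq> e \<Longrightarrow> z e e' = 0" using z0 by auto
  have "{t \<in> T. balanced E V t} = T" using bal by auto
  then have "\<forall>e\<in>E - F. \<exists>a. \<forall>x. z e x = (\<Sum>t\<in>T. a t * t x)"
    using span[OF z(1)] by (simp add: int_span_def)
  from bchoice[OF this] obtain a where a0: "\<forall>e\<in>E - F. \<forall>x. z e x = (\<Sum>t\<in>T. a e t * t x)" ..
  have a: "\<And>e x. e \<in> E - F \<Longrightarrow> z e x = (\<Sum>t\<in>T. a e t * t x)" using a0 by blast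
  have indep: "\<forall>t\<in>T. k t = 0" if k: "\<And>e. (\<Sum>t\<in>T. k t * t e) = 0" for k
  proof (rule ccontr)
    assume "\<not> ?thesis"
    then obtain t0 where t0: "t0 \<in> T" "k t0 \<noteq> 0" by auto
    \<comment> \<open>The coefficients of \<open>k t0 * z e\<close> after \<open>t0\<close> has been
      eliminated by means of the relation \<open>k\<close>; they vanish at \<open>t0\<close>. So
      \<open>card (E - F)\<close> independent vectors would lie in the rational span of fewer
      elements.\<close>
    define m where "m e t = a e t * k t0 - a e t0 * k t" for e t
    have m: "k t0 * z e x = (\<Sum>t\<in>T. m e t * t x)" if "e \<in> E - F" for e x
    proof -
      have "(\<Sum>t\<in>T. m e t * t x) = k t0 * (\<Sum>t\<in>T. a e t * t x) - a e t0 * (\<Sum>t\<in>T. k t * t x)"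
        by (simp add: m_def sum_subtractf sum_distrib_left algebra_simps)
      then show ?thesis using k a[OF that] by simp
    qed
    have "card (T - {t0}) < card (E - F)"
      using cardT t0 finT by (metis card_Diff1_less less_le_trans)
    from exists_nontrivial_relation[OF _ _ this, of "\<lambda>e t. of_int (m e t) :: rat"] obtain c :: "_ \<Rightarrow> rat"
      where c: "\<exists>e\<in>E - F. c e \<noteq> 0" "\<forall>t\<in>T - {t0}. (\<Sum>e\<in>E - F. c e * of_int (m e t)) = 0"
      using finT finE by auto
    have cT: "(\<Sum>e\<in>E - F. c e * of_int (m e t)) = 0" if "t \<in> T" for t
    proof (cases "t = t0")
      case True
      then show ?thesis by (simp add: m_def)
    qed (use c that in auto)
    have "c e' = 0" if e': "e' \<in> E - F" for e'
    proof -
      have "(\<Sum>e\<in>E - F. c e * of_int (k t0 * z e e')) = (\<Sum>e\<in>E - F. \<Sum>t\<in>T. c e * of_int (m e t) * of_int (t e'))"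
        by (intro sum.cong refl) (simp only: m of_int_sum sum_distrib_left of_int_mult mult.assoc)
      also have "\<dots> = (\<Sum>t\<in>T. (\<Sum>e\<in>E - F. c e * of_int (m e t)) * of_int (t e'))"
        by (subst sum.swap) (simp add: sum_distrib_right)
      also have "\<dots> = 0" using cT by simp
      also have "(\<Sum>e\<in>E - F. c e * of_int (k t0 * z e e'))
          = (\<Sum>e\<in>E - F. if e = e' then c e' * of_int (k t0 * z e' e') else 0)"
        using z(3) e' by (intro sum.cong refl) auto
      also have "\<dots> = c e' * of_int (k t0 * z e' e')" using e' finE by simp
      finally show ?thesis using t0 z(2)[OF e'] by simp
    qed
    then show False using c(1) by blast
  qed
  show ?thesis by (rule that[of T]) (use finT bal indep span in auto)
qed

section \<open>Walks and separations\<close>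

definition adj :: "'v set \<Rightarrow> 'v set set \<Rightarrow> 'v \<Rightarrow> 'v \<Rightarrow> bool" where
  "adj W E u v \<longleftrightarrow> u \<in> W \<and> v \<in> W \<and> {u, v} \<in> E"

definition walk :: "'v set \<Rightarrow> 'v set set \<Rightarrow> 'v list \<Rightarrow> bool" where
  "walk W E xs \<longleftrightarrow> xs \<noteq> [] \<and> set xs \<subseteq> W \<and> successively (\<lambda>u v. {u, v} \<in> E) xs"

lemma joined_iff_walk: "joined W E x y \<longleftrightarrow> (\<exists>xs. walk W E xs \<and> hd xs = x \<and> last xs = y)"
  by (simp add: joined_def walk_def successively_conv_nth conj_ac)

lemma walk_rtranclp: "walk W E xs \<Longrightarrow> (adj W E)\<^sup>*\<^sup>* (hd xs) (last xs)"
proof (induction xs rule: induct_list012)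
  case (3 x y zs)
  then have "walk W E (y # zs)" "adj W E x y" by (auto simp: walk_def adj_def)
  then show ?case using 3(2) by (auto intro: converse_rtranclp_into_rtranclp)
qed (auto simp: walk_def)

lemma joined_iff: "joined W E x y \<longleftrightarrow> x \<in> W \<and> y \<in> W \<and> (adj W E)\<^sup>*\<^sup>* x y"
proof
  assume "joined W E x y"
  then obtain xs where xs: "walk W E xs" "hd xs = x" "last xs = y" by (auto simp: joined_iff_walk)
  then have "x \<in> W" "y \<in> W" by (auto simp: walk_def)
  then show "x \<in> W \<and> y \<in> W \<and> (adj W E)\<^sup>*\<^sup>* x y" using walk_rtranclp[OF xs(1)] xs by auto
next
  assume *: "x \<in> W \<and> y \<in> W \<and> (adj W E)\<^sup>*\<^sup>* x y"
  then have "(adj W E)\<^sup>*\<^sup>* x y" by blast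
  then have "\<exists>xs. walk W E xs \<and> hd xs = x \<and> last xs = y"
  proof (induction rule: rtranclp_induct)
    case base
    show ?case using * by (intro exI[of _ "[x]"]) (auto simp: walk_def)
  next
    case (step y z)
    then obtain xs where xs: "walk W E xs" "hd xs = x" "last xs = y" by blast
    then have "walk W E (xs @ [z])" using step(2)
      by (auto simp: walk_def adj_def successively_append_iff)
    then show ?case using xs by (intro exI[of _ "xs @ [z]"]) (auto simp: walk_def)
  qed
  then show "joined W E x y" by (simp add: joined_iff_walk)
qed

lemma joined_refl: "x \<in> W \<Longrightarrow> joined W E x x"
  by (simp add: joined_iff)

lemma joined_sym: "joined W E x y \<Longrightarrow> joined W E y x"
proof -
  have "symp (adj W E)" by (auto simp: symp_def adj_def insert_commute)
  then have "symp ((adj W E)\<^sup>*\<^sup>*)" by (rule symp_rtranclp)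
  then show "joined W E x y \<Longrightarrow> joined W E y x" by (auto simp: joined_iff dest: sympD)
qed

lemma joined_trans: "joined W E x y \<Longrightarrow> joined W E y z \<Longrightarrow> joined W E x z"
  by (auto simp: joined_iff)

lemma joined_step: "joined W E x y \<Longrightarrow> {y, z} \<in> E \<Longrightarrow> z \<in> W \<Longrightarrow> joined W E x z"
  by (auto simp: joined_iff adj_def intro: rtranclp.rtrancl_into_rtrancl)

lemma joined_mono:
  assumes "joined W E x y" "W \<subseteq> W'" "\<And>e. e \<in> E \<Longrightarrow> e \<subseteq> W \<Longrightarrow> e \<in> E'"
  shows "joined W' E' x y"
proof -
  have "adj W E u v \<Longrightarrow> adj W' E' u v" for u v using assms(2,3) by (auto simp: adj_def)
  then have "(adj W E)\<^sup>*\<^sup>* x y \<Longrightarrow> (adj W' E')\<^sup>*\<^sup>* x y" using mono_rtranclp[of "adj W E" "adj W' E'"] by blast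
  then show ?thesis using assms by (auto simp: joined_iff)
qed

lemma connected_graphI:
  assumes "r \<in> W" "\<And>w. w \<in> W \<Longrightarrow> joined W E r w"
  shows "connected_graph W E"
proof -
  have "joined W E x y" if "x \<in> W" "y \<in> W" for x y
    using joined_trans[OF joined_sym[OF assms(2)[OF that(1)]] assms(2)[OF that(2)]] .
  then show ?thesis using assms(1) by (auto simp: connected_graph_def)
qed

text \<open>No edge inside \<open>W\<close> joins \<open>X - {c}\<close> to \<open>Y - {c}\<close>.
  A side may be as small as \<open>{c}\<close>; where proper sides matter, this is stated separately
  or follows from what the sides contain.\<close>

definition separation :: "'v set set \<Rightarrow> 'v set \<Rightarrow> 'v set \<Rightarrow> 'v set \<Rightarrow> 'v \<Rightarrow> bool" where
  "separation E W X Y c \<longleftrightarrow> X \<union> Y = W \<and> X \<inter> Y = {c} \<and> (\<forall>e\<in>E. e \<subseteq> W \<longrightarrow> e \<subseteq> X \<or> e \<subseteq> Y)"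

lemma separation_sym: "separation E W X Y c \<Longrightarrow> separation E W Y X c"
  by (auto simp: separation_def)

lemma separation_avoid:
  assumes "separation E W X Y c" "joined U E x y" "U \<subseteq> W" "c \<notin> U" "x \<in> X"
  shows "y \<in> X"
proof -
  have "(adj U E)\<^sup>*\<^sup>* x y" using assms by (simp add: joined_iff)
  then show ?thesis
  proof (induction rule: rtranclp_induct)
    case (step y z)
    then have "{y, z} \<subseteq> X \<or> {y, z} \<subseteq> Y" using assms(1,3) by (auto simp: adj_def separation_def)
    moreover have "y \<notin> Y" using step assms(1,4) by (auto simp: adj_def separation_def)
    ultimately show ?case by auto
  qed (use assms in auto)
qed

text \<open>With vertices strictly on both sides, \<open>B\<close> would have \<open>c\<close> as a
  cut vertex, or would pass between the sides without using \<open>c\<close>.\<close>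

lemma separation_biconnected:
  assumes sep: "separation E W X Y c" and B: "biconnected_sub (V, E) B" and "fst B \<subseteq> W"
  shows "fst B \<subseteq> X \<or> fst B \<subseteq> Y"
proof (rule ccontr)
  assume "\<not> ?thesis"
  then obtain x y where xy: "x \<in> fst B" "x \<notin> X" "y \<in> fst B" "y \<notin> Y" by blast
  have "X \<union> Y = W" "X \<inter> Y = {c}" using sep by (auto simp: separation_def)
  then have side: "x \<in> Y" "y \<in> X" "x \<noteq> c" "y \<noteq> c" using xy \<open>fst B \<subseteq> W\<close> by blast+
  have j: "joined (fst B) (snd B) y x"
    using B xy by (auto simp: biconnected_sub_def connected_graph_def)
  have BE: "snd B \<subseteq> E" using B by (auto simp: biconnected_sub_def subgraph_def)
  have "joined (fst B - {c}) E y x"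
  proof (cases "c \<in> fst B")
    case True
    have "\<not> cut_vertex B c" using B by (auto simp: biconnected_sub_def)
    then have "joined (fst B - {c}) {e \<in> snd B. c \<notin> e} y x"
      using True j xy side by (auto simp: cut_vertex_def)
    then show ?thesis by (rule joined_mono) (use BE in auto)
  next
    case False
    then show ?thesis using j by (intro joined_mono[OF j]) (use BE in auto)
  qed
  from separation_avoid[OF sep this] have "x \<in> X" using side(2) \<open>fst B \<subseteq> W\<close> by blast
  then show False using xy(2) by blast
qed

text \<open>Cut the walk at its first visit to \<open>c\<close>; before that it cannot leave
  \<open>X\<close>.\<close>

lemma separation_side_joined:
  assumes sep: "separation E V X Y c" and "W \<subseteq> V" "joined W E a c" "a \<in> X"
  shows "joined (W \<inter> X) E a c"
proof -
  have "(adj W E)\<^sup>*\<^sup>* a c" using assms by (simp add: joined_iff)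
  then have "a \<in> X \<longrightarrow> (adj (W \<inter> X) E)\<^sup>*\<^sup>* a c"
  proof (induction rule: converse_rtranclp_induct)
    case (step a b)
    show ?case
    proof (cases "a = c")
      case False
      show ?thesis
      proof
        assume "a \<in> X"
        then have "a \<notin> Y" using False sep by (auto simp: separation_def)
        then have "b \<in> X" using step(1) sep assms(2) by (auto simp: adj_def separation_def)
        then have "adj (W \<inter> X) E a b" using step(1) \<open>a \<in> X\<close> by (auto simp: adj_def)
        then show "(adj (W \<inter> X) E)\<^sup>*\<^sup>* a c"
          using step(3) \<open>b \<in> X\<close> by (auto intro: converse_rtranclp_into_rtranclp)
      qed
    qed simp
  qed simp
  moreover have "c \<in> X" using sep by (auto simp: separation_def)
  ultimately show ?thesis using assms by (auto simp: joined_iff)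
qed

lemma separation_side_connected:
  assumes "separation E W X Y c" "connected_graph W E"
  shows "connected_graph X E"
proof (rule connected_graphI)
  show "c \<in> X" using assms by (auto simp: separation_def)
  fix w assume w: "w \<in> X"
  have WX: "W \<inter> X = X" "c \<in> W" "w \<in> W" using assms(1) w by (auto simp: separation_def)
  then have "joined W E w c" using assms(2) by (auto simp: connected_graph_def)
  from separation_side_joined[OF assms(1) _ this w] show "joined X E c w" using WX by (auto intro: joined_sym)
qed

text \<open>The other side \<open>Y\<close> is glued to whichever of \<open>P\<close> and
  \<open>Q\<close> contains the attaching vertex \<open>v\<close>.\<close>

lemma separation_extend:
  assumes "separation E W X Y v" "separation E X P Q d"
  shows "\<exists>P' Q'. P \<subseteq> P' \<and> Q \<subseteq> Q' \<and> separation E W P' Q' d"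
proof -
  have XY: "X \<union> Y = W" "X \<inter> Y = {v}" "\<forall>e\<in>E. e \<subseteq> W \<longrightarrow> e \<subseteq> X \<or> e \<subseteq> Y"
    using assms(1) by (auto simp: separation_def)
  have PQ: "P \<union> Q = X" "P \<inter> Q = {d}" "\<forall>e\<in>E. e \<subseteq> X \<longrightarrow> e \<subseteq> P \<or> e \<subseteq> Q"
    using assms(2) by (auto simp: separation_def)
  have "v \<in> P \<or> v \<in> Q" using XY(2) PQ(1) by blast
  then show ?thesis
  proof
    assume "v \<in> P"
    then have "(P \<union> Y) \<union> Q = W" "(P \<union> Y) \<inter> Q = {d}" using XY(1,2) PQ(1,2) by blast+
    moreover have "\<forall>e\<in>E. e \<subseteq> W \<longrightarrow> e \<subseteq> P \<union> Y \<or> e \<subseteq> Q"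
      using XY(3) PQ(3) by (metis le_supI1 le_supI2)
    ultimately have "separation E W (P \<union> Y) Q d" by (simp add: separation_def)
    then show ?thesis by blast
  next
    assume "v \<in> Q"
    have "P \<inter> Y \<subseteq> {v}" using XY(2) PQ(1) by blast
    then have "P \<inter> Y \<subseteq> P \<inter> Q" using \<open>v \<in> Q\<close> by blast
    then have "P \<inter> (Q \<union> Y) = {d}" using PQ(2) by blast
    moreover have "P \<union> (Q \<union> Y) = W" using XY(1) PQ(1) by blast
    moreover have "\<forall>e\<in>E. e \<subseteq> W \<longrightarrow> e \<subseteq> P \<or> e \<subseteq> Q \<union> Y"
      using XY(3) PQ(3) by (metis le_supI1 le_supI2)
    ultimately have "separation E W P (Q \<union> Y) d" by (simp add: separation_def)
    then show ?thesis by blast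
  qed
qed

lemma induced_cut_vertex_separation:
  assumes G: "simple_graph V E" and "W \<subseteq> V" and cut: "cut_vertex (W, {e \<in> E. e \<subseteq> W}) v"
  obtains X Y where "separation E W X Y v" "X \<subset> W" "Y \<subset> W"
proof -
  obtain x y where xy: "x \<in> W - {v}" "y \<in> W - {v}" "v \<in> W"
    "\<not> joined (W - {v}) {e \<in> {e \<in> E. e \<subseteq> W}. v \<notin> e} x y"
    using cut by (auto simp: cut_vertex_def)
  have nj: "\<not> joined (W - {v}) E x y"
  proof
    assume "joined (W - {v}) E x y"
    then have "joined (W - {v}) {e \<in> {e \<in> E. e \<subseteq> W}. v \<notin> e} x y" by (rule joined_mono) auto
    then show False using xy by blast
  qed
  define C where "C = {a \<in> W - {v}. joined (W - {v}) E x a}"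
  have "separation E W (insert v C) (W - C) v"
    unfolding separation_def
  proof (intro conjI ballI impI)
    show "insert v C \<union> (W - C) = W" "insert v C \<inter> (W - C) = {v}" using xy by (auto simp: C_def)
    fix e assume e: "e \<in> E" "e \<subseteq> W"
    then obtain p q where pq: "e = {p, q}" using simple_graph_edge(3)[OF G] by blast
    have "q \<in> C" if "p \<in> C" "q \<noteq> v"
      using that e pq by (auto simp: C_def intro: joined_step)
    moreover have "p \<in> C" if "q \<in> C" "p \<noteq> v"
      using that e pq by (auto simp: C_def insert_commute intro: joined_step)
    ultimately show "e \<subseteq> insert v C \<or> e \<subseteq> W - C" using e pq by auto
  qed
  moreover have "insert v C \<subset> W" using xy nj by (auto simp: C_def)
  moreover have "x \<in> C" using xy by (auto simp: C_def intro: joined_refl)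
  then have "W - C \<subset> W" using xy by auto
  ultimately show ?thesis by (rule that)
qed

text \<open>Otherwise take a smallest connected \<open>W\<close> containing both blocks whose
  separations all extend to \<open>V\<close>. A cut vertex of the graph induced on \<open>W\<close>
  would either separate the blocks or leave both on a smaller such set.\<close>

lemma distinct_blocks_separated:
  assumes G: "simple_graph V E" and con: "connected_graph V E"
    and B: "is_block (V, E) B1" "is_block (V, E) B2" "B1 \<noteq> B2"
  shows "\<exists>X Y c. separation E V X Y c \<and> fst B1 \<subseteq> X \<and> fst B2 \<subseteq> Y"
proof (rule ccontr)
  assume no: "\<not> ?thesis"
  define piece where "piece W \<longleftrightarrow> W \<subseteq> V \<and> connected_graph W E \<and> fst B1 \<union> fst B2 \<subseteq> W \<and>
    (\<forall>X Y c. separation E W X Y c \<longrightarrow> (\<exists>X' Y'. X \<subseteq> X' \<and> Y \<subseteq> Y' \<and> separation E V X' Y' c))" for W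
  have bi: "biconnected_sub (V, E) B1" "biconnected_sub (V, E) B2" using B by (auto simp: is_block_def)
  then have "piece V" using con by (auto simp: piece_def biconnected_sub_def subgraph_def)
  then obtain W where W: "piece W" and min: "\<And>W'. piece W' \<Longrightarrow> card W \<le> card W'"
    using ex_has_least_nat[of piece V card] by blast
  have finW: "finite W" using W G by (auto simp: piece_def simple_graph_def intro: finite_subset)
  have noW: "\<not> (fst B1 \<subseteq> X \<and> fst B2 \<subseteq> Y)" if sepW: "separation E W X Y c" for X Y c
  proof -
    obtain X' Y' where "X \<subseteq> X'" "Y \<subseteq> Y'" "separation E V X' Y' c"
      using W sepW unfolding piece_def by meson
    then show ?thesis using no by blast
  qed
  have smaller: False if sep: "separation E W X Y v" and "X \<subset> W" "fst B1 \<union> fst B2 \<subseteq> X" for X Y v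
  proof -
    have "\<exists>P' Q'. P \<subseteq> P' \<and> Q \<subseteq> Q' \<and> separation E V P' Q' d" if sepX: "separation E X P Q d" for P Q d
    proof -
      obtain P' Q' where 1: "P \<subseteq> P'" "Q \<subseteq> Q'" "separation E W P' Q' d"
        using separation_extend[OF sep sepX] by blast
      then obtain P'' Q'' where "P' \<subseteq> P''" "Q' \<subseteq> Q''" "separation E V P'' Q'' d"
        using W unfolding piece_def by meson
      then show ?thesis using 1 by blast
    qed
    moreover have "connected_graph X E"
      using separation_side_connected[OF sep] W by (simp add: piece_def)
    ultimately have "piece X" using that W by (auto simp: piece_def)
    then have "card W \<le> card X" by (rule min)
    then show False using psubset_card_mono[OF finW that(2)] by simp
  qed
  let ?H = "(W, {e \<in> E. e \<subseteq> W})"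
  have nocut: "\<not> cut_vertex ?H v" for v
  proof
    assume cut: "cut_vertex ?H v"
    have "W \<subseteq> V" using W by (simp add: piece_def)
    from induced_cut_vertex_separation[OF G this cut] obtain X Y where
      XY: "separation E W X Y v" "X \<subset> W" "Y \<subset> W" by blast
    have BW: "fst B1 \<subseteq> W" "fst B2 \<subseteq> W" using W by (auto simp: piece_def)
    have "fst B1 \<subseteq> X \<or> fst B1 \<subseteq> Y" "fst B2 \<subseteq> X \<or> fst B2 \<subseteq> Y"
      using separation_biconnected[OF XY(1) bi(1) BW(1)] separation_biconnected[OF XY(1) bi(2) BW(2)]
      by auto
    then show False
      using noW[OF XY(1)] noW[OF separation_sym[OF XY(1)]] smaller[OF XY(1,2)]
        smaller[OF separation_sym[OF XY(1)] XY(3)] by blast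
  qed
  have "joined W {e \<in> E. e \<subseteq> W} x y" if "joined W E x y" for x y
    using that by (rule joined_mono) auto
  moreover have "connected_graph W E" using W by (simp add: piece_def)
  ultimately have "connected_graph W {e \<in> E. e \<subseteq> W}" by (simp add: connected_graph_def)
  with nocut have H: "biconnected_sub (V, E) ?H"
    using W by (auto simp: biconnected_sub_def subgraph_def piece_def)
  have sub: "subgraph B ?H" if "biconnected_sub (V, E) B" "fst B \<subseteq> W" for B
    using that by (fastforce simp: biconnected_sub_def subgraph_def)
  \<comment> \<open>The induced graph on \<open>W\<close> is biconnected and contains both blocks,
    so each of them equals it by maximality.\<close>
  have "?H = B1" "?H = B2"
    using B(1,2) H sub[OF bi(1)] sub[OF bi(2)] W by (auto simp: is_block_def piece_def)
  then show False using B(3) by simp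
qed

text \<open>A single edge is biconnected. A biconnected subgraph through it with the largest total
  number of vertices and edges is maximal in both components, hence a block.\<close>

lemma edge_in_block:
  assumes G: "simple_graph V E" and e: "{u, v} \<in> E"
  shows "\<exists>B. is_block (V, E) B \<and> {u, v} \<in> snd B"
proof -
  have finV: "finite V" and finE: "finite E" using G simple_graph_finite_edges by (auto simp: simple_graph_def)
  define P where "P H \<longleftrightarrow> biconnected_sub (V, E) H \<and> {u, v} \<in> snd H" for H
  have uv: "{u, v} \<subseteq> V" using simple_graph_edge(2)[OF G e] .
  have "connected_graph {u, v} {{u, v}}"
    by (rule connected_graphI[of u]) (auto intro: joined_refl joined_step)
  moreover have "\<not> cut_vertex ({u, v}, {{u, v}}) w" for w
    by (auto simp: cut_vertex_def intro: joined_refl)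
  ultimately have P0: "P ({u, v}, {{u, v}})"
    using uv e by (auto simp: P_def biconnected_sub_def subgraph_def)
  have sub: "fst H \<subseteq> V \<and> snd H \<subseteq> E" if "P H" for H
    using that by (auto simp: P_def biconnected_sub_def subgraph_def)
  let ?c = "\<lambda>H :: 'a set \<times> 'a set set. card (fst H) + card (snd H)"
  have "?c H < Suc (card V + card E)" if "P H" for H
    using sub[OF that] finV finE by (simp add: add_mono card_mono less_Suc_eq_le)
  then obtain B where B: "P B" "\<And>H. P H \<Longrightarrow> ?c H \<le> ?c B"
    using Lattices_Big.ex_has_greatest_nat[of P _ ?c, OF P0] by blast
  have "H = B" if H: "biconnected_sub (V, E) H" "subgraph B H" for H
  proof -
    have BH: "fst B \<subseteq> fst H" "snd B \<subseteq> snd H" using H by (auto simp: subgraph_def)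
    then have "P H" using H B by (auto simp: P_def)
    then have le: "?c H \<le> ?c B" by (rule B(2))
    have fin: "finite (fst H)" "finite (snd H)"
      using sub[OF \<open>P H\<close>] finV finE finite_subset by blast+
    have "card (fst B) \<le> card (fst H)" "card (snd B) \<le> card (snd H)"
      using BH fin by (auto intro: card_mono)
    then have "card (fst B) = card (fst H)" "card (snd B) = card (snd H)" using le by linarith+
    then have "fst B = fst H" "snd B = snd H"
      using card_subset_eq[OF fin(1) BH(1)] card_subset_eq[OF fin(2) BH(2)] by auto
    then show ?thesis by (simp add: prod_eq_iff)
  qed
  then have "is_block (V, E) B" using B(1) unfolding P_def is_block_def by blast
  then show ?thesis using B(1) unfolding P_def by blast
qed

section \<open>Relations crossing a cut vertex\<close>

definition flow :: "'v set set \<Rightarrow> 'v set \<Rightarrow> 'v \<Rightarrow> ('v set \<Rightarrow> int) \<Rightarrow> int" where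
  "flow E X c z = (\<Sum>e | e \<in> E \<and> c \<in> e \<and> e \<subseteq> X. z e)"

definition crossing :: "'v set set \<Rightarrow> 'v set \<Rightarrow> 'v \<Rightarrow> 'v set \<Rightarrow> bool" where
  "crossing E X c W \<longleftrightarrow> (\<exists>z. balanced E W z \<and> flow E X c z \<noteq> 0)"

lemma flow_sum: "flow E X c (\<lambda>e. \<Sum>t\<in>S. k t * t e) = (\<Sum>t\<in>S. k t * flow E X c t)"
  unfolding flow_def sum_distrib_left by (rule sum.swap)

lemma separation_edge_one_side:
  assumes "simple_graph V E" "separation E V X Y c" "e \<in> E"
  shows "e \<subseteq> X \<longleftrightarrow> \<not> e \<subseteq> Y"
proof -
  obtain u v where uv: "u \<noteq> v" "e = {u, v}" using simple_graph_edge(3)[OF assms(1,3)] by blast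
  have "X \<inter> Y = {c}" using assms(2) by (simp add: separation_def)
  then have "\<not> (e \<subseteq> X \<and> e \<subseteq> Y)" using uv by auto
  moreover have "e \<subseteq> X \<or> e \<subseteq> Y"
    using assms simple_graph_edge(2)[OF assms(1,3)] by (auto simp: separation_def)
  ultimately show ?thesis by blast
qed

text \<open>At a vertex of \<open>X\<close> other than \<open>c\<close> all edges lie inside
  \<open>X\<close>, and at a vertex outside \<open>X\<close> none do. So cutting \<open>z\<close>
  down to \<open>X\<close> can disturb the balance at \<open>c\<close> only, and by exactly the
  flow.\<close>

lemma sum_incident_side:
  assumes G: "simple_graph V E" and sep: "separation E V X Y c" and z: "balanced E W z"
  shows "(\<Sum>e | e \<in> E \<and> v \<in> e. if e \<subseteq> X then z e else 0) = (if v = c then flow E X c z else 0)"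
proof -
  have fin: "finite {e \<in> E. v \<in> e}" using simple_graph_finite_edges[OF G] by simp
  have eq: "(\<Sum>e | e \<in> E \<and> v \<in> e. if e \<subseteq> X then z e else 0) = (\<Sum>e | e \<in> E \<and> v \<in> e \<and> e \<subseteq> X. z e)"
    using sum.inter_filter[OF fin, of z "\<lambda>e. e \<subseteq> X"] by (simp add: conj_assoc)
  show ?thesis
  proof (cases "v = c")
    case True
    then show ?thesis unfolding eq flow_def by simp
  next
    case False
    show ?thesis
    proof (cases "v \<in> X")
      case True
      then have "v \<notin> Y" using False sep by (auto simp: separation_def)
      then have "{e. e \<in> E \<and> v \<in> e \<and> e \<subseteq> X} = {e. e \<in> E \<and> v \<in> e}"
        using separation_edge_one_side[OF G sep] by blast
      then show ?thesis using False z unfolding eq balanced_def by simp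
    next
      case False': False
      then have "{e. e \<in> E \<and> v \<in> e \<and> e \<subseteq> X} = {}" by blast
      then have "(\<Sum>e | e \<in> E \<and> v \<in> e \<and> e \<subseteq> X. z e) = 0" by (simp only: sum.empty)
      then show ?thesis using False unfolding eq by simp
    qed
  qed
qed

lemma flow_swap:
  assumes G: "simple_graph V E" and sep: "separation E V X Y c" and z: "balanced E W z"
  shows "flow E Y c z = - flow E X c z"
proof -
  have "flow E X c z + flow E Y c z
    = (\<Sum>e | e \<in> E \<and> c \<in> e. (if e \<subseteq> X then z e else 0) + (if e \<subseteq> Y then z e else 0))"
    using sum_incident_side[OF G sep z, of c] sum_incident_side[OF G separation_sym[OF sep] z, of c]
    by (simp add: sum.distrib)
  also have "\<dots> = (\<Sum>e | e \<in> E \<and> c \<in> e. z e)"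
    using separation_edge_one_side[OF G sep] by (intro sum.cong refl) auto
  also have "\<dots> = 0" using z by (simp add: balanced_def)
  finally show ?thesis by simp
qed

lemma crossing_swap:
  assumes "simple_graph V E" "separation E V X Y c"
  shows "crossing E X c W \<longleftrightarrow> crossing E Y c W"
proof -
  have "flow E X c z \<noteq> 0 \<longleftrightarrow> flow E Y c z \<noteq> 0" if "balanced E W z" for z
    using flow_swap[OF assms that] by simp
  then show ?thesis unfolding crossing_def by blast
qed

lemma flow_side_zero:
  assumes "simple_graph V E" "separation E V X Y c" "balanced E X z"
  shows "flow E X c z = 0"
proof -
  have "flow E X c z = (\<Sum>e | e \<in> E \<and> c \<in> e. if e \<subseteq> X then z e else 0)"
    using sum_incident_side[OF assms, of c] by simp
  also have "\<dots> = (\<Sum>e | e \<in> E \<and> c \<in> e. z e)"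
    using assms(3) by (intro sum.cong refl) (auto simp: balanced_def)
  also have "\<dots> = 0" using assms(3) by (simp add: balanced_def)
  finally show ?thesis .
qed

text \<open>A relation with zero flow through \<open>c\<close> splits into relations on the two sides, so the basis
  of a complete intersection contains at most one element with nonzero flow. Every crossing
  induced subgraph has to contain that element.\<close>

lemma crossing_inter:
  fixes V :: "'v set"
  assumes G: "simple_graph V E" and CI: "graph_complete_intersection TYPE('k::field) E"
    and sep: "separation E V X Y c" and W: "crossing E X c W1" "crossing E X c W2"
  shows "crossing E X c (W1 \<inter> W2)"
proof -
  obtain T where T: "finite T" "\<And>t. t \<in> T \<Longrightarrow> balanced E V t"
    "\<And>k. (\<And>e. (\<Sum>t\<in>T. k t * t e) = 0) \<Longrightarrow> \<forall>t\<in>T. k t = 0"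
    "\<And>W z. balanced E W z \<Longrightarrow> z \<in> int_span {t \<in> T. balanced E W t}"
    by (rule complete_intersection_basis[OF G CI]) blast
  let ?f = "flow E X c"
  have TX: "?f t = 0" if "balanced E X t" for t using flow_side_zero[OF G sep that] .
  have TY: "?f t = 0" if "balanced E Y t" for t
    using flow_side_zero[OF G separation_sym[OF sep] that] flow_swap[OF G sep that] by simp
  have unique: "t = t'" if t: "t \<in> T" "t' \<in> T" "?f t \<noteq> 0" "?f t' \<noteq> 0" for t t'
  proof (rule ccontr)
    assume neq: "t \<noteq> t'"
    \<comment> \<open>The combination of \<open>t\<close> and \<open>t'\<close> whose flow cancels;
      it splits into a relation in \<open>X\<close> and one in \<open>Y\<close>.\<close>
    define z where "z e = ?f t' * t e - ?f t * t' e" for e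
    have "e \<in> E \<and> e \<subseteq> V" if "z e \<noteq> 0" for e
    proof -
      have "t e \<noteq> 0 \<or> t' e \<noteq> 0" using that by (auto simp: z_def)
      then show ?thesis using T(2)[OF t(1)] T(2)[OF t(2)] by (auto simp: balanced_def)
    qed
    moreover have "(\<Sum>e | e \<in> E \<and> v \<in> e. z e) = 0" for v
      using T(2)[OF t(1)] T(2)[OF t(2)]
      by (simp add: balanced_def z_def sum_subtractf flip: sum_distrib_left)
    ultimately have z: "balanced E V z" by (simp add: balanced_def)
    have fz: "?f z = 0"
      by (simp add: flow_def z_def[abs_def] sum_subtractf flip: sum_distrib_left)
    define zX where "zX e = (if e \<subseteq> X then z e else 0)" for e
    have incX: "(\<Sum>e | e \<in> E \<and> v \<in> e. zX e) = 0" for v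
      using sum_incident_side[OF G sep z, of v] fz by (simp add: zX_def)
    have bX: "balanced E X zX" using z incX by (auto simp: balanced_def zX_def)
    have bY: "balanced E Y (\<lambda>e. z e - zX e)"
      unfolding balanced_def
    proof (intro conjI allI impI)
      fix e assume "z e - zX e \<noteq> 0"
      then have "z e \<noteq> 0" "\<not> e \<subseteq> X" by (auto simp: zX_def split: if_splits)
      then show "e \<in> E" "e \<subseteq> Y"
        using z separation_edge_one_side[OF G sep, of e] by (auto simp: balanced_def)
    next
      fix v show "(\<Sum>e | e \<in> E \<and> v \<in> e. z e - zX e) = 0"
        using incX z by (simp add: sum_subtractf balanced_def)
    qed
    let ?TX = "{t \<in> T. balanced E X t}" and ?TY = "{t \<in> T. balanced E Y t}"
    obtain k where k: "\<And>e. zX e = (\<Sum>t\<in>?TX. k t * t e)"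
      using T(4)[OF bX] by (auto simp: int_span_def)
    obtain l where l: "\<And>e. z e - zX e = (\<Sum>t\<in>?TY. l t * t e)"
      using T(4)[OF bY] by (auto simp: int_span_def)
    \<comment> \<open>Coefficients of the relation obtained by writing \<open>z\<close> in two ways.
      Elements supported on one side have zero flow, so \<open>t\<close> does not occur in the
      second expression and its coefficient is the flow of \<open>t'\<close>.\<close>
    define m where "m s = (if s = t then ?f t' else 0) - (if s = t' then ?f t else 0)
      - (if balanced E X s then k s else 0) - (if balanced E Y s then l s else 0)" for s
    have "(\<Sum>s\<in>T. m s * s e) = 0" for e
    proof -
      have "(\<Sum>s\<in>T. m s * s e) = (\<Sum>s\<in>T. if s = t then ?f t' * s e else 0)
        - (\<Sum>s\<in>T. if s = t' then ?f t * s e else 0)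
        - (\<Sum>s\<in>T. if balanced E X s then k s * s e else 0)
        - (\<Sum>s\<in>T. if balanced E Y s then l s * s e else 0)"
        unfolding sum_subtractf[symmetric]
        by (intro sum.cong refl) (auto simp: m_def left_diff_distrib)
      also have "\<dots> = z e - (\<Sum>s\<in>?TX. k s * s e) - (\<Sum>s\<in>?TY. l s * s e)"
        using t T(1) by (simp add: z_def sum.inter_filter)
      also have "\<dots> = 0" using k[of e] l[of e] by simp
      finally show ?thesis .
    qed
    then have "m t = 0" using T(3)[of m] t(1) by blast
    moreover have "\<not> balanced E X t" "\<not> balanced E Y t" using TX TY t(3) by auto
    ultimately show False using neq t(4) by (simp add: m_def)
  qed
  have hit: "\<exists>t\<in>T. balanced E W t \<and> ?f t \<noteq> 0" if "crossing E X c W" for W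
  proof (rule ccontr)
    assume no: "\<not> ?thesis"
    obtain z where z: "balanced E W z" "?f z \<noteq> 0" using \<open>crossing E X c W\<close> by (auto simp: crossing_def)
    obtain k where k: "\<And>e. z e = (\<Sum>t | t \<in> T \<and> balanced E W t. k t * t e)"
      using T(4)[OF z(1)] by (auto simp: int_span_def)
    have "?f z = (\<Sum>t | t \<in> T \<and> balanced E W t. k t * ?f t)"
      unfolding flow_sum[symmetric] by (rule arg_cong[where f = ?f]) (use k in blast)
    also have "\<dots> = 0" using no by (intro sum.neutral) auto
    finally show False using z(2) by simp
  qed
  obtain t where t: "t \<in> T" "balanced E W1 t" "?f t \<noteq> 0" using hit[OF W(1)] by blast
  obtain t' where t': "t' \<in> T" "balanced E W2 t'" "?f t' \<noteq> 0" using hit[OF W(2)] by blast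
  have "t = t'" using unique t t' by blast
  then have "balanced E (W1 \<inter> W2) t" using t t' by (auto simp: balanced_def)
  then show ?thesis using t(3) by (auto simp: crossing_def)
qed

text \<open>An odd closed walk through \<open>c\<close>, with alternating signs on its edges, has incidence
  \<open>2\<close> at \<open>c\<close> and \<open>0\<close> elsewhere.\<close>

lemma nonbipartite_relation:
  assumes G: "simple_graph V E" and U: "c \<in> U" "\<And>a. a \<in> U \<Longrightarrow> joined U E c a"
    and B: "\<not> bipartite B" "snd B \<subseteq> E" "\<And>e. e \<in> snd B \<Longrightarrow> e \<subseteq> U"
  shows "\<exists>z :: 'v set \<Rightarrow> int. (\<forall>e. z e \<noteq> 0 \<longrightarrow> e \<in> E \<and> e \<subseteq> U) \<and>
    (\<forall>v. (\<Sum>e | e \<in> E \<and> v \<in> e. z e) = (if v = c then 2 else 0))"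
proof -
  have finE: "finite E" by (rule simple_graph_finite_edges[OF G])
  \<comment> \<open>This models an alternating walk from \<open>c\<close> to \<open>v\<close>:
    \<open>s = 1\<close> for odd length, \<open>s = -1\<close> for even length. For the empty walk
    the two contributions at \<open>c\<close> cancel, and adding an edge negates the old weights and
    flips \<open>s\<close>.\<close>
  define R where "R s v \<longleftrightarrow> (\<exists>z :: 'v set \<Rightarrow> int. (\<forall>e. z e \<noteq> 0 \<longrightarrow> e \<in> E \<and> e \<subseteq> U) \<and>
    (\<forall>w. (\<Sum>e | e \<in> E \<and> w \<in> e. z e) = (if w = v then 1 else 0) + (if w = c then s else 0)))"
    for s v
  have base: "R (-1) c" unfolding R_def by (rule exI[of _ "\<lambda>e. 0"]) simp
  have flip: "R (- s) u" if R: "R s v" and uv: "u \<in> U" "v \<in> U" "{u, v} \<in> E" for s u v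
  proof -
    obtain z where z: "\<And>e. z e \<noteq> 0 \<Longrightarrow> e \<in> E \<and> e \<subseteq> U"
      "\<And>w. (\<Sum>e | e \<in> E \<and> w \<in> e. z e) = (if w = v then 1 else 0) + (if w = c then s else 0)"
      using R unfolding R_def by blast
    have neq: "u \<noteq> v" using simple_graph_edge(3)[OF G uv(3)] by auto
    define z' where "z' e = (if e = {u, v} then 1 else 0) - z e" for e
    have "e \<in> E \<and> e \<subseteq> U" if "z' e \<noteq> 0" for e
    proof (cases "e = {u, v}")
      case False
      then show ?thesis using that z(1)[of e] by (simp add: z'_def)
    qed (use uv in auto)
    moreover have "(\<Sum>e | e \<in> E \<and> w \<in> e. z' e) = (if w = u then 1 else 0) + (if w = c then - s else 0)" for w
    proof -
      have "(\<Sum>e | e \<in> E \<and> w \<in> e. if e = {u, v} then 1 else 0) = (if w \<in> {u, v} then 1 else 0 :: int)"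
        using finE uv(3) by simp
      then show ?thesis using z(2)[of w] neq by (auto simp: z'_def sum_subtractf)
    qed
    ultimately show ?thesis unfolding R_def by blast
  qed
  have all: "R 1 a \<or> R (-1) a" if a: "a \<in> U" for a
  proof -
    have "(adj U E)\<^sup>*\<^sup>* c a" using U(2)[OF a] by (simp add: joined_iff)
    then show ?thesis
    proof (induction rule: rtranclp_induct)
      case (step y w)
      then have "w \<in> U" "y \<in> U" "{w, y} \<in> E" by (auto simp: adj_def insert_commute)
      then show ?case using step(3) flip[of 1 y w] flip[of "-1" y w] by auto
    qed (use base in blast)
  qed
  \<comment> \<open>If no vertex were reachable with both parities, \<open>R 1\<close> would be a
    proper 2-colouring of \<open>B\<close>. The difference of the two weightings at such a
    \<open>v\<close> cancels there and leaves 2 at \<open>c\<close>.\<close>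
  obtain v where v: "R 1 v" "R (-1) v"
  proof (rule ccontr)
    assume "\<not> thesis"
    then have no: "\<not> (R 1 v \<and> R (-1) v)" for v using that by blast
    have "R 1 x \<noteq> R 1 y" if e: "e \<in> snd B" and xy: "x \<in> e" "y \<in> e" "x \<noteq> y" for e x y
    proof -
      have "e \<in> E" "e \<subseteq> U" using e B by auto
      then have "e = {x, y}" using simple_graph_edge(3)[OF G, of e] xy by auto
      then have E: "{x, y} \<in> E" "{y, x} \<in> E" "x \<in> U" "y \<in> U"
        using \<open>e \<in> E\<close> \<open>e \<subseteq> U\<close> by (auto simp: insert_commute)
      show ?thesis
        using flip[of 1 y x] flip[of "-1" y x] flip[of 1 x y] no[of x] no[of y] all E by auto
    qed
    then have "bipartite B" unfolding bipartite_def by blast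
    then show False using B(1) by blast
  qed
  obtain z where z: "\<And>e. z e \<noteq> 0 \<Longrightarrow> e \<in> E \<and> e \<subseteq> U"
    "\<And>w. (\<Sum>e | e \<in> E \<and> w \<in> e. z e) = (if w = v then 1 else 0) + (if w = c then 1 else 0 :: int)"
    using v(1) unfolding R_def by blast
  obtain z' where z': "\<And>e. z' e \<noteq> 0 \<Longrightarrow> e \<in> E \<and> e \<subseteq> U"
    "\<And>w. (\<Sum>e | e \<in> E \<and> w \<in> e. z' e) = (if w = v then 1 else 0) + (if w = c then -1 else 0 :: int)"
    using v(2) unfolding R_def by blast
  have "e \<in> E \<and> e \<subseteq> U" if "z e - z' e \<noteq> 0" for e
    using that z(1)[of e] z'(1)[of e] by fastforce
  then show ?thesis
    using z(2) z'(2) by (intro exI[of _ "\<lambda>e. z e - z' e"]) (simp add: sum_subtractf)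
qed

text \<open>Connectedness forces \<open>c\<close> into \<open>W\<close>. Each non-bipartite block
  gives a weighting on its side with incidence 2 at \<open>c\<close> and 0 elsewhere; their
  difference is balanced and has flow 2.\<close>

lemma connected_crossing:
  assumes G: "simple_graph V E" and sep: "separation E V X Y c"
    and W: "W \<subseteq> V" "connected_graph W E"
    and B1: "biconnected_sub (V, E) B1" "\<not> bipartite B1" "fst B1 \<subseteq> W" "fst B1 \<subseteq> X"
    and B2: "biconnected_sub (V, E) B2" "\<not> bipartite B2" "fst B2 \<subseteq> W" "fst B2 \<subseteq> Y"
  shows "crossing E X c W"
proof -
  have XYc: "X \<inter> Y = {c}" using sep by (simp add: separation_def)
  obtain a b where ab: "a \<in> fst B1" "b \<in> fst B2"
    using B1(1) B2(1) by (auto simp: biconnected_sub_def connected_graph_def)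
  have cW: "c \<in> W"
  proof (rule ccontr)
    assume c: "c \<notin> W"
    have "joined W E a b" using W(2) ab B1(3) B2(3) by (auto simp: connected_graph_def)
    from separation_avoid[OF sep this W(1) c] have "b \<in> X" using ab B1(4) by blast
    then have "b \<in> X \<inter> Y" using ab B2(4) by blast
    then show False using ab B2(3) XYc c by auto
  qed
  have joinX: "joined (W \<inter> X) E c a" if "a \<in> W \<inter> X" for a
    using separation_side_joined[OF sep W(1), of a] W(2) cW that
    by (auto simp: connected_graph_def intro: joined_sym)
  have joinY: "joined (W \<inter> Y) E c a" if "a \<in> W \<inter> Y" for a
    using separation_side_joined[OF separation_sym[OF sep] W(1), of a] W(2) cW that
    by (auto simp: connected_graph_def intro: joined_sym)
  have s1: "snd B1 \<subseteq> E" "\<And>e. e \<in> snd B1 \<Longrightarrow> e \<subseteq> W \<inter> X"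
    using B1(1,3,4) unfolding biconnected_sub_def subgraph_def by auto blast+
  have s2: "snd B2 \<subseteq> E" "\<And>e. e \<in> snd B2 \<Longrightarrow> e \<subseteq> W \<inter> Y"
    using B2(1,3,4) unfolding biconnected_sub_def subgraph_def by auto blast+
  have cX: "c \<in> W \<inter> X" "c \<in> W \<inter> Y" using cW XYc by auto
  obtain z1 :: "'a set \<Rightarrow> int" where z1: "\<And>e. z1 e \<noteq> 0 \<Longrightarrow> e \<in> E \<and> e \<subseteq> W \<inter> X"
    "\<And>v. (\<Sum>e | e \<in> E \<and> v \<in> e. z1 e) = (if v = c then 2 else 0)"
    using nonbipartite_relation[OF G cX(1) joinX B1(2) s1] by blast
  obtain z2 :: "'a set \<Rightarrow> int" where z2: "\<And>e. z2 e \<noteq> 0 \<Longrightarrow> e \<in> E \<and> e \<subseteq> W \<inter> Y"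
    "\<And>v. (\<Sum>e | e \<in> E \<and> v \<in> e. z2 e) = (if v = c then 2 else 0)"
    using nonbipartite_relation[OF G cX(2) joinY B2(2) s2] by blast
  define z where "z e = z1 e - z2 e" for e
  have "e \<in> E \<and> e \<subseteq> W" if "z e \<noteq> 0" for e
    using that z1(1)[of e] z2(1)[of e] by (cases "z1 e = 0") (auto simp: z_def)
  then have bal: "balanced E W z"
    using z1(2) z2(2) by (auto simp: balanced_def z_def sum_subtractf)
  have "flow E X c z = (\<Sum>e | e \<in> E \<and> c \<in> e. if e \<subseteq> X then z e else 0)"
    using sum_incident_side[OF G sep bal, of c] by simp
  also have "\<dots> = (\<Sum>e | e \<in> E \<and> c \<in> e. z1 e)"
  proof (rule sum.cong[OF refl])
    fix e assume "e \<in> {e \<in> E. c \<in> e}"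
    then have "e \<subseteq> X \<longleftrightarrow> \<not> e \<subseteq> Y" using separation_edge_one_side[OF G sep] by blast
    then show "(if e \<subseteq> X then z e else 0) = z1 e"
      using z1(1)[of e] z2(1)[of e] by (auto simp: z_def)
  qed
  also have "\<dots> = 2" using z1(2) by simp
  finally show ?thesis using bal by (auto simp: crossing_def)
qed

text \<open>Double counting: weighting the incidences of the \<open>Y\<close> part of
  \<open>z\<close> by \<open>\<sigma>\<close> gives \<open>\<sigma> c\<close> times the flow, and
  also a sum over edges of terms \<open>(\<sigma> u + \<sigma> v) * y e\<close>, all 0. Such a
  \<open>\<sigma>\<close> is a signed 2-colouring of the component of \<open>c\<close> and may be 0
  elsewhere.\<close>

lemma not_crossing:
  fixes \<sigma> :: "'v \<Rightarrow> int"
  assumes G: "simple_graph V E" and sep: "separation E V X Y c"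
    and \<sigma>: "\<sigma> c \<noteq> 0" "\<And>u v. {u, v} \<in> E \<Longrightarrow> u \<in> W \<inter> Y \<Longrightarrow> v \<in> W \<inter> Y \<Longrightarrow> \<sigma> u + \<sigma> v = 0"
  shows "\<not> crossing E X c W"
proof -
  have finE: "finite E" and finV: "finite V"
    using simple_graph_finite_edges[OF G] G by (auto simp: simple_graph_def)
  have "flow E X c z = 0" if z: "balanced E W z" for z
  proof -
    define y where "y e = (if e \<subseteq> Y then z e else 0)" for e
    have inc: "(\<Sum>e | e \<in> E \<and> v \<in> e. y e) = (if v = c then flow E Y c z else 0)" for v
      using sum_incident_side[OF G separation_sym[OF sep] z, of v] by (simp add: y_def)
    have cV: "c \<in> V" using sep by (auto simp: separation_def)
    have "\<sigma> c * flow E Y c z = (\<Sum>v\<in>V. \<sigma> v * (\<Sum>e | e \<in> E \<and> v \<in> e. y e))"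
      using cV finV by (simp add: inc if_distrib cong: if_cong)
    also have "\<dots> = (\<Sum>v\<in>V. \<Sum>e\<in>E. if v \<in> e then \<sigma> v * y e else 0)"
      using finE by (simp add: sum_distrib_left sum.inter_filter if_distrib cong: if_cong)
    also have "\<dots> = (\<Sum>e\<in>E. \<Sum>v\<in>V. if v \<in> e then \<sigma> v * y e else 0)" by (rule sum.swap)
    also have "\<dots> = 0"
    proof (rule sum.neutral, rule ballI)
      fix e assume e: "e \<in> E"
      obtain u v where uv: "u \<noteq> v" "e = {u, v}" using simple_graph_edge(3)[OF G e] by blast
      have "e \<subseteq> V" using simple_graph_edge(2)[OF G e] .
      then have "{w \<in> V. w \<in> e} = {u, v}" using uv by auto
      then have "(\<Sum>v\<in>V. if v \<in> e then \<sigma> v * y e else 0) = (\<sigma> u + \<sigma> v) * y e"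
        using finV uv(1) by (simp add: distrib_right flip: sum.inter_filter)
      also have "\<dots> = 0"
      proof (cases "y e = 0")
        case False
        then have "e \<subseteq> Y" "e \<subseteq> W" using z by (auto simp: y_def balanced_def split: if_splits)
        then have "\<sigma> u + \<sigma> v = 0" using \<sigma>(2)[of u v] e uv by auto
        then show ?thesis by simp
      qed simp
      finally show "(\<Sum>v\<in>V. if v \<in> e then \<sigma> v * y e else 0) = 0" .
    qed
    finally have "flow E Y c z = 0" using \<sigma>(1) by simp
    then show ?thesis using flow_swap[OF G sep z] by simp
  qed
  then show ?thesis by (auto simp: crossing_def)
qed

section \<open>Shortest paths between vertex sets\<close>

definition shortest :: "'v set \<Rightarrow> 'v set set \<Rightarrow> 'v set \<Rightarrow> 'v set \<Rightarrow> 'v list \<Rightarrow> bool" where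
  "shortest V E P Q xs \<longleftrightarrow> walk V E xs \<and> hd xs \<in> P \<and> last xs \<in> Q \<and>
     (\<forall>ys. walk V E ys \<longrightarrow> hd ys \<in> P \<longrightarrow> last ys \<in> Q \<longrightarrow> length xs \<le> length ys)"

lemma shortest_exists:
  assumes "connected_graph V E" "P \<subseteq> V" "Q \<subseteq> V" "P \<noteq> {}" "Q \<noteq> {}"
  shows "\<exists>xs. shortest V E P Q xs"
proof -
  obtain p q where "p \<in> P" "q \<in> Q" using assms by blast
  then have "joined V E p q" using assms by (auto simp: connected_graph_def)
  then obtain ys where ys: "walk V E ys" "hd ys \<in> P" "last ys \<in> Q"
    using \<open>p \<in> P\<close> \<open>q \<in> Q\<close> by (auto simp: joined_iff_walk)
  then have "\<exists>xs. (walk V E xs \<and> hd xs \<in> P \<and> last xs \<in> Q) \<and>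
      (\<forall>ys. walk V E ys \<and> hd ys \<in> P \<and> last ys \<in> Q \<longrightarrow> length xs \<le> length ys)"
    by (intro ex_has_least_nat) blast
  then show ?thesis unfolding shortest_def by blast
qed

lemma walk_rev: "walk V E xs \<Longrightarrow> walk V E (rev xs)"
  by (auto simp: walk_def insert_commute)

lemma shortest_rev:
  assumes "shortest V E P Q xs"
  shows "shortest V E Q P (rev xs)"
  unfolding shortest_def
proof (intro conjI allI impI)
  have ne: "xs \<noteq> []" using assms by (simp add: shortest_def walk_def)
  show "walk V E (rev xs)" using assms by (simp add: shortest_def walk_rev)
  show "hd (rev xs) \<in> Q" "last (rev xs) \<in> P"
    using assms ne by (auto simp: shortest_def hd_rev last_rev)
  fix ys assume ys: "walk V E ys" "hd ys \<in> Q" "last ys \<in> P"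
  then have "ys \<noteq> []" by (simp add: walk_def)
  then have "length xs \<le> length (rev ys)"
    using assms walk_rev[OF ys(1)] ys(2,3) unfolding shortest_def by (metis hd_rev last_rev)
  then show "length (rev xs) \<le> length ys" by simp
qed

lemma walk_take: "walk V E xs \<Longrightarrow> walk V E (take (Suc n) xs)"
  unfolding walk_def successively_conv_nth by (auto dest: in_set_takeD)

lemma walk_drop: "walk V E xs \<Longrightarrow> n < length xs \<Longrightarrow> walk V E (drop n xs)"
  unfolding walk_def successively_conv_nth by (auto dest: in_set_dropD)

lemma walk_append:
  "walk V E xs \<Longrightarrow> walk V E ys \<Longrightarrow> {last xs, hd ys} \<in> E \<Longrightarrow> walk V E (xs @ ys)"
  by (auto simp: walk_def successively_append_iff)

lemma last_take_Suc: "n < length xs \<Longrightarrow> last (take (Suc n) xs) = xs ! n"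
  by (simp add: take_Suc_conv_app_nth)

lemma walk_nth_joined:
  assumes "walk V E xs" "n < length xs"
  shows "joined V E (hd xs) (xs ! n)"
proof -
  have "hd (take (Suc n) xs) = hd xs" "last (take (Suc n) xs) = xs ! n"
    using assms by (auto simp: walk_def last_take_Suc)
  then show ?thesis using walk_take[OF assms(1), of n] by (auto simp: joined_iff_walk)
qed

context
  fixes V :: "'v set" and E P Q xs
  assumes sh: "shortest V E P Q xs"
begin

lemma shortest_walk: "walk V E xs"
  using sh by (simp add: shortest_def)

lemma shortest_le: "walk V E ys \<Longrightarrow> hd ys \<in> P \<Longrightarrow> last ys \<in> Q \<Longrightarrow> length xs \<le> length ys"
  using sh by (simp add: shortest_def)

lemma shortest_nonempty: "xs \<noteq> []"
  using shortest_walk by (simp add: walk_def)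

lemma shortest_nth_start:
  assumes "i < length xs" "xs ! i \<in> P"
  shows "i = 0"
proof -
  have "length xs \<le> length (drop i xs)"
    using assms sh by (intro shortest_le walk_drop) (auto simp: shortest_def hd_drop_conv_nth)
  then show ?thesis using assms(1) by simp
qed

lemma shortest_nth_chord:
  assumes "i < j" "j < length xs" "{xs ! i, xs ! j} \<in> E"
  shows "j = Suc i"
proof -
  have "length xs \<le> length (take (Suc i) xs @ drop j xs)"
  proof (rule shortest_le)
    show "walk V E (take (Suc i) xs @ drop j xs)"
      using assms shortest_walk
      by (intro walk_append walk_take walk_drop) (auto simp: last_take_Suc hd_drop_conv_nth)
    show "hd (take (Suc i) xs @ drop j xs) \<in> P" "last (take (Suc i) xs @ drop j xs) \<in> Q"
      using assms sh shortest_nonempty by (auto simp: shortest_def)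
  qed
  then show ?thesis using assms by simp
qed

text \<open>At a repetition the walk could start later, if the first occurrence is the start, or
  jump to the second occurrence from the predecessor of the first.\<close>

lemma shortest_distinct: "distinct xs"
proof -
  have "xs ! i \<noteq> xs ! j" if ij: "i < j" "j < length xs" for i j
  proof
    assume eq: "xs ! i = xs ! j"
    show False
    proof (cases i)
      case 0
      then have "xs ! j \<in> P" using eq sh shortest_nonempty by (auto simp: shortest_def hd_conv_nth)
      then show False using shortest_nth_start[of j] ij by simp
    next
      case (Suc k)
      have "Suc k < length xs" using Suc ij by simp
      then have "{xs ! k, xs ! Suc k} \<in> E"
        using shortest_walk unfolding walk_def successively_conv_nth by blast
      then have "{xs ! k, xs ! j} \<in> E" using eq Suc by simp
      then show False using shortest_nth_chord[of k j] ij Suc by simp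
    qed
  qed
  then show ?thesis unfolding distinct_conv_nth by (metis nat_neq_iff)
qed

lemma shortest_nth_neighbour:
  assumes "i < length xs" "{xs ! i, w} \<in> E" "w \<in> Q" "w \<in> V"
  shows "length xs \<le> i + 2"
proof -
  have "length xs \<le> length (take (Suc i) xs @ [w])"
  proof (rule shortest_le)
    have "walk V E [w]" using assms(4) by (simp add: walk_def)
    then show "walk V E (take (Suc i) xs @ [w])"
      using assms shortest_walk by (intro walk_append walk_take) (auto simp: last_take_Suc)
    show "hd (take (Suc i) xs @ [w]) \<in> P" "last (take (Suc i) xs @ [w]) \<in> Q"
      using assms sh shortest_nonempty by (auto simp: shortest_def)
  qed
  then show ?thesis using assms by simp
qed

lemma shortest_consecutive:
  assumes "i < length xs" "j < length xs" "i \<noteq> j" "{xs ! i, xs ! j} \<in> E"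
  shows "j = Suc i \<or> i = Suc j"
  using shortest_nth_chord[of i j] shortest_nth_chord[of j i] assms
  by (cases "i < j") (auto simp: insert_commute)

lemma shortest_meets_separation:
  assumes "separation E V X Y c" "P \<subseteq> X" "Q \<subseteq> Y"
  shows "c \<in> set xs"
proof (rule ccontr)
  assume c: "c \<notin> set xs"
  have "walk (set xs) E xs" using shortest_walk by (simp add: walk_def)
  then have "joined (set xs) E (hd xs) (last xs)" by (auto simp: joined_iff_walk)
  moreover have "set xs \<subseteq> V" using shortest_walk by (simp add: walk_def)
  ultimately have "last xs \<in> X"
    using separation_avoid[OF assms(1)] c sh assms(2) by (auto simp: shortest_def)
  moreover have "last xs \<in> Y" using sh assms(3) by (auto simp: shortest_def)
  moreover have "last xs \<in> set xs" using shortest_nonempty by simp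
  ultimately show False using assms(1) c by (auto simp: separation_def)
qed

end

lemma shortest_nth_end:
  assumes sh: "shortest V E P Q xs" and "i < length xs" "xs ! i \<in> Q"
  shows "Suc i = length xs"
proof -
  have "rev xs ! (length xs - Suc i) \<in> Q" using assms by (simp add: rev_nth)
  moreover have "length xs - Suc i < length (rev xs)" using assms(2) by (cases xs) auto
  ultimately have "length xs - Suc i = 0" using shortest_nth_start[OF shortest_rev[OF sh]] by blast
  then show ?thesis using assms(2) by simp
qed

section \<open>Non-bipartite blocks of a complete intersection\<close>

definition position :: "'v list \<Rightarrow> 'v \<Rightarrow> nat" where
  "position xs v = (THE i. i < length xs \<and> xs ! i = v)"

lemma position_nth: "distinct xs \<Longrightarrow> i < length xs \<Longrightarrow> position xs (xs ! i) = i"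
  unfolding position_def by (rule the_equality) (auto simp: nth_eq_iff_index_eq)

text \<open>On the side \<open>Y\<close>, the part of \<open>W\<close> attached to \<open>c\<close>
  is only a piece of the path before \<open>xs ! i\<close>: \<open>P\<close> meets \<open>Y\<close>
  at most in \<open>c\<close>, and path vertices before \<open>xs ! i\<close> are too far from
  \<open>Q\<close> to have neighbours there. Alternating signs along the path colour it.\<close>

lemma not_crossing_off_path_vertex:
  assumes G: "simple_graph V E" and sep: "separation E V X Y c"
    and sh: "shortest V E P Q xs" and PQ: "P \<subseteq> X" "Q \<subseteq> V"
    and i: "Suc i < length xs" and a: "c = xs ! a" "a \<le> i"
    and W: "W \<subseteq> P \<union> set xs \<union> Q" "xs ! i \<notin> W"
  shows "\<not> crossing E X c W"
proof -
  have dist: "distinct xs" by (rule shortest_distinct[OF sh])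
  note pos = position_nth[OF dist]
  \<comment> \<open>The case \<open>b = a\<close> adds something only if \<open>a = i\<close>: then
    \<open>c\<close> is outside \<open>W\<close>, but \<open>\<sigma> c\<close> must still be
    nonzero.\<close>
  define good where "good v \<longleftrightarrow> (\<exists>b<length xs. v = xs ! b \<and> (b < i \<or> b = a))" for v
  define \<sigma> :: "_ \<Rightarrow> int" where "\<sigma> v = (if good v then (-1) ^ position xs v else 0)" for v
  have near: "\<sigma> u + \<sigma> v = 0"
    if uv: "{u, v} \<in> E" "u \<in> W \<inter> Y" "v \<in> W \<inter> Y" and u: "good u" for u v
  proof -
    obtain b where b: "b < length xs" "u = xs ! b" "b < i \<or> b = a" using u by (auto simp: good_def)
    have "b \<noteq> i" using b(2) uv(2) W(2) by auto
    then have bi: "b < i" using b(3) a(2) by auto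
    have neq: "u \<noteq> v" using simple_graph_edge(3)[OF G uv(1)] by auto
    have "v \<notin> Q"
    proof
      assume "v \<in> Q"
      then have "length xs \<le> b + 2"
        using shortest_nth_neighbour[OF sh b(1), of v] uv(1) b(2) PQ(2) by auto
      then show False using bi i by simp
    qed
    moreover have "v \<in> set xs" if "v \<in> P"
    proof -
      have "v \<in> X \<inter> Y" using that PQ uv by auto
      then have "v = xs ! a" using sep a(1) by (auto simp: separation_def)
      then show ?thesis using a(2) i by simp
    qed
    ultimately have "v \<in> set xs" using uv(3) W(1) by auto
    then obtain d where d: "d < length xs" "v = xs ! d" by (auto simp: in_set_conv_nth)
    have "d \<noteq> i" using d(2) uv(3) W(2) by auto
    have db: "d = Suc b \<or> b = Suc d"
      using shortest_consecutive[OF sh b(1) d(1)] uv(1) b(2) d(2) neq by auto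
    then have "d < i" using bi \<open>d \<noteq> i\<close> by auto
    then have "good v" using d by (auto simp: good_def)
    then have "\<sigma> u = (-1) ^ b" "\<sigma> v = (-1) ^ d" using u pos b d by (auto simp: \<sigma>_def)
    then show ?thesis using db by auto
  qed
  show ?thesis
  proof (rule not_crossing[OF G sep, of \<sigma>])
    have "good c" unfolding good_def using a i by (intro exI[of _ a]) simp
    then show "\<sigma> c \<noteq> 0" by (simp add: \<sigma>_def)
    fix u v assume uv: "{u, v} \<in> E" "u \<in> W \<inter> Y" "v \<in> W \<inter> Y"
    then have "{v, u} \<in> E" by (simp add: insert_commute)
    then show "\<sigma> u + \<sigma> v = 0"
      using near[OF uv] near[of v u] uv by (cases "good u"; cases "good v") (auto simp: \<sigma>_def)
  qed
qed

lemma biconnected_sub_joined: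
  assumes "biconnected_sub (V, E) B" "x \<in> fst B" "y \<in> fst B" "fst B \<subseteq> W"
  shows "joined W E x y"
proof -
  have "joined (fst B) (snd B) x y" "snd B \<subseteq> E"
    using assms(1-3) by (auto simp: biconnected_sub_def connected_graph_def subgraph_def)
  then show ?thesis using joined_mono[of "fst B" "snd B" x y W E] assms(4) by blast
qed

lemma path_union_connected:
  assumes B: "biconnected_sub (V, E) B1" "biconnected_sub (V, E) B2"
    and sh: "shortest V E (fst B1) (fst B2) xs"
  shows "connected_graph (fst B1 \<union> set xs \<union> fst B2) E"
proof (rule connected_graphI)
  let ?W = "fst B1 \<union> set xs \<union> fst B2"
  have hl: "hd xs \<in> fst B1" "last xs \<in> fst B2" using sh by (auto simp: shortest_def)
  show "hd xs \<in> ?W" using hl by blast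
  have w: "walk ?W E xs" using shortest_walk[OF sh] by (auto simp: walk_def)
  have path: "joined ?W E (hd xs) v" if v: "v \<in> set xs" for v
    using v walk_nth_joined[OF w] by (auto simp: in_set_conv_nth)
  have "last xs \<in> set xs" using shortest_nonempty[OF sh] by simp
  then have "joined ?W E (hd xs) (last xs)" by (rule path)
  moreover have "joined ?W E (last xs) v" if "v \<in> fst B2" for v
    using biconnected_sub_joined[OF B(2) hl(2) that, of ?W] by blast
  ultimately have "joined ?W E (hd xs) v" if "v \<in> fst B2" for v using that joined_trans by metis
  moreover have "joined ?W E (hd xs) v" if "v \<in> fst B1" for v
    using biconnected_sub_joined[OF B(1) hl(1) that, of ?W] by blast
  ultimately show "joined ?W E (hd xs) v" if "v \<in> ?W" for v using that path by blast
qed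

lemma component_connected:
  assumes "a \<in> U"
  shows "connected_graph {w. joined U E a w} E"
proof (rule connected_graphI)
  let ?W = "{w. joined U E a w}"
  show "a \<in> ?W" using assms by (simp add: joined_refl)
  fix w assume "w \<in> ?W"
  then have "(adj U E)\<^sup>*\<^sup>* a w" by (simp add: joined_iff)
  then show "joined ?W E a w"
  proof (induction rule: rtranclp_induct)
    case base
    show ?case using assms by (simp add: joined_refl)
  next
    case (step y z)
    then have "joined U E a z"
      using joined_step[of U E a y z] by (auto simp: adj_def joined_iff)
    then show ?case using step by (intro joined_step[OF step(3)]) (auto simp: adj_def)
  qed
qed

text \<open>Otherwise two crossing sets are available: the blocks with the path, and the component
  of \<open>V - {xs ! i}\<close> that contains both blocks. Their intersection misses
  \<open>xs ! i\<close>, so the path is broken there and the intersection cannot cross.\<close>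

lemma path_vertex_separates_blocks:
  fixes V :: "'v set"
  assumes G: "simple_graph V E" and con: "connected_graph V E"
    and CI: "graph_complete_intersection TYPE('k::field) E"
    and B1: "is_block (V, E) B1" "\<not> bipartite B1" and B2: "is_block (V, E) B2" "\<not> bipartite B2"
    and neq: "B1 \<noteq> B2" and sh: "shortest V E (fst B1) (fst B2) xs"
    and i: "0 < i" "Suc i < length xs"
  shows "\<not> joined (V - {xs ! i}) E (hd xs) (last xs)"
proof
  let ?y = "xs ! i" and ?W1 = "fst B1 \<union> set xs \<union> fst B2"
  assume j: "joined (V - {?y}) E (hd xs) (last xs)"
  have bi: "biconnected_sub (V, E) B1" "biconnected_sub (V, E) B2"
    using B1 B2 by (auto simp: is_block_def)
  then have BV: "fst B1 \<subseteq> V" "fst B2 \<subseteq> V" by (auto simp: biconnected_sub_def subgraph_def)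
  obtain X Y c where sep: "separation E V X Y c" and XY: "fst B1 \<subseteq> X" "fst B2 \<subseteq> Y"
    using distinct_blocks_separated[OF G con B1(1) B2(1) neq] by blast
  have hl: "hd xs \<in> fst B1" "last xs \<in> fst B2" using sh by (auto simp: shortest_def)
  have y: "?y \<notin> fst B1" "?y \<notin> fst B2"
    using shortest_nth_start[OF sh, of i] shortest_nth_end[OF sh, of i] i by auto
  define W2 where "W2 = {w. joined (V - {?y}) E (hd xs) w}"
  have "fst B1 \<subseteq> W2"
    using biconnected_sub_joined[OF bi(1) hl(1), of _ "V - {?y}"] BV(1) y(1) unfolding W2_def by blast
  moreover have "fst B2 \<subseteq> W2"
    using biconnected_sub_joined[OF bi(2) hl(2), of _ "V - {?y}"] BV(2) y(2) joined_trans[OF j]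
    unfolding W2_def by blast
  moreover have "connected_graph W2 E"
    unfolding W2_def using hl(1) BV(1) y(1) by (intro component_connected) auto
  moreover have W2V: "W2 \<subseteq> V - {?y}" by (auto simp: W2_def joined_iff)
  ultimately have "crossing E X c W2"
    using connected_crossing[OF G sep _ _ bi(1) B1(2) _ XY(1) bi(2) B2(2) _ XY(2)] by blast
  moreover have "?W1 \<subseteq> V" using BV shortest_walk[OF sh] by (auto simp: walk_def)
  then have "crossing E X c ?W1"
    using connected_crossing[OF G sep _ path_union_connected[OF bi sh] bi(1) B1(2) _ XY(1)
        bi(2) B2(2) _ XY(2)] by blast
  ultimately have cross: "crossing E X c (?W1 \<inter> W2)" by (intro crossing_inter[OF G CI sep])
  have yW: "?y \<notin> ?W1 \<inter> W2" using W2V by blast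
  have "c \<in> set xs" by (rule shortest_meets_separation[OF sh sep XY])
  then obtain a where a: "a < length xs" "c = xs ! a" by (auto simp: in_set_conv_nth)
  show False
  proof (cases "a \<le> i")
    case True
    show False
      using not_crossing_off_path_vertex[OF G sep sh XY(1) BV(2) i(2) a(2) True _ yW] cross by blast
  next
    case False
    \<comment> \<open>If \<open>c\<close> comes after \<open>xs ! i\<close>, the reversed path with
      the sides exchanged gives the first case.\<close>
    let ?i = "length xs - Suc i" and ?a = "length xs - Suc a"
    have "\<not> crossing E Y c (?W1 \<inter> W2)"
    proof (rule not_crossing_off_path_vertex[OF G separation_sym[OF sep] shortest_rev[OF sh] XY(2) BV(1)])
      show "Suc ?i < length (rev xs)" "?a \<le> ?i" "c = rev xs ! ?a" "rev xs ! ?i \<notin> ?W1 \<inter> W2"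
        using i a False yW by (auto simp: rev_nth)
      show "?W1 \<inter> W2 \<subseteq> fst B2 \<union> set (rev xs) \<union> fst B1" by auto
    qed
    then show False using cross crossing_swap[OF G sep] by blast
  qed
qed

text \<open>A shortest path works. If two of its edges lay in one block, that block minus the far
  end of the earlier edge would still be connected, and would bypass this inner vertex of the path,
  which separates the blocks.\<close>

lemma nonbipartite_blocks_contiguous:
  fixes V :: "'v set"
  assumes G: "simple_graph V E" and con: "connected_graph V E"
    and CI: "graph_complete_intersection TYPE('k::field) E"
    and B1: "is_block (V, E) B1" "\<not> bipartite B1" and B2: "is_block (V, E) B2" "\<not> bipartite B2"
    and neq: "B1 \<noteq> B2"
  shows "contiguous (V, E) B1 B2"
proof -
  have "fst B1 \<subseteq> V" "fst B1 \<noteq> {}" "fst B2 \<subseteq> V" "fst B2 \<noteq> {}"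
    using B1 B2 by (auto simp: is_block_def biconnected_sub_def subgraph_def connected_graph_def)
  then obtain xs where sh: "shortest V E (fst B1) (fst B2) xs"
    using shortest_exists[OF con] by blast
  have w: "walk V E xs" by (rule shortest_walk[OF sh])
  have dist: "distinct xs" by (rule shortest_distinct[OF sh])
  have edge: "{xs ! i, xs ! Suc i} \<in> E" if "Suc i < length xs" for i
    using w that unfolding walk_def successively_conv_nth by blast
  define f where "f i = (SOME B. is_block (V, E) B \<and> {xs ! i, xs ! Suc i} \<in> snd B)" for i
  have f: "is_block (V, E) (f i)" "{xs ! i, xs ! Suc i} \<in> snd (f i)" if "Suc i < length xs" for i
    using someI_ex[OF edge_in_block[OF G edge[OF that]]] by (auto simp: f_def)
  have diff: "f i \<noteq> f j" if ij: "i < j" "Suc j < length xs" for i j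
  proof
    assume eq: "f i = f j"
    let ?C = "f i" and ?y = "xs ! Suc i"
    have C: "biconnected_sub (V, E) ?C" "\<not> cut_vertex ?C ?y"
      using f(1)[of i] ij by (auto simp: is_block_def biconnected_sub_def)
    have CV: "fst ?C \<subseteq> V" "snd ?C \<subseteq> E" "\<And>e. e \<in> snd ?C \<Longrightarrow> e \<subseteq> fst ?C"
      using C(1) by (auto simp: biconnected_sub_def subgraph_def)
    have "{xs ! i, ?y} \<subseteq> fst ?C" "{xs ! j, xs ! Suc j} \<subseteq> fst ?C"
      using CV(3) f(2)[of i] f(2)[of j] ij eq by auto
    then have mem: "xs ! i \<in> fst ?C" "?y \<in> fst ?C" "xs ! Suc j \<in> fst ?C" by auto
    have ne: "xs ! i \<noteq> ?y" "xs ! Suc j \<noteq> ?y" using dist ij by (auto simp: nth_eq_iff_index_eq)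
    have "joined (fst ?C) (snd ?C) (xs ! i) (xs ! Suc j)"
      using C(1) mem by (auto simp: biconnected_sub_def connected_graph_def)
    then have "joined (fst ?C - {?y}) {e \<in> snd ?C. ?y \<notin> e} (xs ! i) (xs ! Suc j)"
      using C(2) mem ne by (auto simp: cut_vertex_def)
    then have mid: "joined (V - {?y}) E (xs ! i) (xs ! Suc j)"
      by (rule joined_mono) (use CV in auto)
    have "walk (V - {?y}) E (take (Suc i) xs)"
      using walk_take[OF w, of i] dist ij unfolding walk_def
      by (auto simp: in_set_conv_nth nth_eq_iff_index_eq)
    from walk_nth_joined[OF this, of i] have left: "joined (V - {?y}) E (hd xs) (xs ! i)"
      using ij shortest_nonempty[OF sh] by simp
    have "walk (V - {?y}) E (drop (Suc j) xs)"
      using walk_drop[OF w, of "Suc j"] dist ij unfolding walk_def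
      by (auto simp: in_set_conv_nth nth_eq_iff_index_eq)
    then have right: "joined (V - {?y}) E (xs ! Suc j) (last xs)"
      unfolding joined_iff_walk using ij
      by (intro exI[of _ "drop (Suc j) xs"]) (auto simp: hd_drop_conv_nth)
    have "joined (V - {?y}) E (hd xs) (last xs)"
      using joined_trans[OF joined_trans[OF left mid] right] .
    then show False
      using path_vertex_separates_blocks[OF G con CI B1 B2 neq sh, of "Suc i"] ij by simp
  qed
  have "inj_on f {i. Suc i < length xs}"
  proof (rule inj_onI)
    fix i j assume "i \<in> {i. Suc i < length xs}" "j \<in> {i. Suc i < length xs}" "f i = f j"
    then show "i = j" using diff[of i j] diff[of j i] by (cases i j rule: linorder_cases) auto
  qed
  moreover have "xs \<noteq> []" "set xs \<subseteq> V" using w by (auto simp: walk_def)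
  moreover have "hd xs \<in> fst B1" "last xs \<in> fst B2" using sh by (auto simp: shortest_def)
  ultimately show ?thesis
    unfolding contiguous_def using f edge dist by (intro exI[of _ xs] exI[of _ f]) auto
qed

text \<open>\<open>B3\<close> lies between \<open>B1\<close> and \<open>B2\<close>: a crossing relation at \<open>c\<close> exists inside \<open>Y'\<close> because of
  \<open>B3\<close>, and along a shortest path from \<open>B1\<close> to \<open>B2\<close> because of \<open>B2\<close>, but not inside their
  intersection, which is only a path beyond \<open>c\<close>.\<close>

lemma no_three_nonbipartite_aux:
  fixes V :: "'v set"
  assumes G: "simple_graph V E" and con: "connected_graph V E"
    and CI: "graph_complete_intersection TYPE('k::field) E"
    and B1: "is_block (V, E) B1" "\<not> bipartite B1" and B2: "is_block (V, E) B2" "\<not> bipartite B2"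
    and B3: "is_block (V, E) B3" "\<not> bipartite B3"
    and sep: "separation E V X Y c" "fst B1 \<subseteq> X" "fst B2 \<subseteq> Y" "fst B3 \<subseteq> Y"
    and sep': "separation E V X' Y' c'" "fst B2 \<subseteq> X'" "fst B1 \<subseteq> Y'" "fst B3 \<subseteq> Y'"
  shows False
proof -
  have bi: "biconnected_sub (V, E) B1" "biconnected_sub (V, E) B2" "biconnected_sub (V, E) B3"
    using B1 B2 B3 by (auto simp: is_block_def)
  have BV: "fst B1 \<subseteq> V" "fst B1 \<noteq> {}" "fst B2 \<subseteq> V" "fst B2 \<noteq> {}"
    using bi by (auto simp: biconnected_sub_def subgraph_def connected_graph_def)
  then obtain xs where sh: "shortest V E (fst B1) (fst B2) xs"
    using shortest_exists[OF con] by blast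
  let ?W = "fst B1 \<union> set xs \<union> fst B2"
  have "?W \<subseteq> V" using BV shortest_walk[OF sh] by (auto simp: walk_def)
  then have "crossing E X c ?W"
    using connected_crossing[OF G sep(1) _ path_union_connected[OF bi(1,2) sh] bi(1) B1(2) _ sep(2)
        bi(2) B2(2) _ sep(3)] by blast
  moreover have "connected_graph Y' E" "Y' \<subseteq> V"
    using separation_side_connected[OF separation_sym[OF sep'(1)] con] sep'(1)
    by (auto simp: separation_def)
  then have "crossing E X c Y'"
    using connected_crossing[OF G sep(1) _ _ bi(1) B1(2) sep'(3) sep(2) bi(3) B3(2) sep'(4) sep(4)]
    by blast
  ultimately have cross: "crossing E X c (?W \<inter> Y')" by (intro crossing_inter[OF G CI sep(1)])
  have dist: "distinct xs" by (rule shortest_distinct[OF sh])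
  note pos = position_nth[OF dist]
  have c: "c \<in> set xs" by (rule shortest_meets_separation[OF sh sep(1-3)])
  have "c' \<in> set (rev xs)" by (rule shortest_meets_separation[OF shortest_rev[OF sh] sep'(1-3)])
  then have c': "c' \<in> set xs" by simp
  \<comment> \<open>\<open>B1\<close> meets \<open>Y\<close> at most in \<open>c\<close>, and
    \<open>B2\<close> meets \<open>Y'\<close> at most in \<open>c'\<close>; both vertices lie on the
    path.\<close>
  have onpath: "u \<in> set xs" if u: "u \<in> ?W \<inter> Y' \<inter> Y" for u
  proof -
    have "u = c" if "u \<in> fst B1" using that u sep(1,2) by (auto simp: separation_def)
    moreover have "u = c'" if "u \<in> fst B2" using that u sep'(1,2) by (auto simp: separation_def)
    ultimately show ?thesis using u c c' by auto
  qed
  define \<sigma> :: "_ \<Rightarrow> int" where "\<sigma> v = (-1) ^ position xs v" for v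
  have "\<not> crossing E X c (?W \<inter> Y')"
  proof (rule not_crossing[OF G sep(1), of \<sigma>])
    show "\<sigma> c \<noteq> 0" by (simp add: \<sigma>_def)
    fix u v assume uv: "{u, v} \<in> E" "u \<in> ?W \<inter> Y' \<inter> Y" "v \<in> ?W \<inter> Y' \<inter> Y"
    obtain i where i: "i < length xs" "u = xs ! i" using onpath[OF uv(2)] by (auto simp: in_set_conv_nth)
    obtain j where j: "j < length xs" "v = xs ! j" using onpath[OF uv(3)] by (auto simp: in_set_conv_nth)
    have "u \<noteq> v" using simple_graph_edge(3)[OF G uv(1)] by auto
    then have "j = Suc i \<or> i = Suc j" using shortest_consecutive[OF sh i(1) j(1)] uv(1) i j by auto
    then show "\<sigma> u + \<sigma> v = 0" using pos i j by (auto simp: \<sigma>_def)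
  qed
  then show False using cross by blast
qed

text \<open>Separating two of the three blocks leaves one of these two alone on its side. No block
  belongs to all three pairs, so at least two different blocks get cut off from the other two, and
  these serve as \<open>B1\<close> and \<open>B2\<close> in the previous lemma.\<close>

lemma no_three_nonbipartite:
  fixes V :: "'v set"
  assumes G: "simple_graph V E" and con: "connected_graph V E"
    and CI: "graph_complete_intersection TYPE('k::field) E"
    and B: "is_block (V, E) B1" "\<not> bipartite B1" "is_block (V, E) B2" "\<not> bipartite B2"
      "is_block (V, E) B3" "\<not> bipartite B3"
    and neq: "B1 \<noteq> B2" "B1 \<noteq> B3" "B2 \<noteq> B3"
  shows False
proof -
  have bi: "biconnected_sub (V, E) B \<and> fst B \<subseteq> V" if "is_block (V, E) B" for B
    using that by (auto simp: is_block_def biconnected_sub_def subgraph_def)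
  define alone where "alone A B C \<longleftrightarrow> (\<exists>X Y c. separation E V X Y c \<and> fst A \<subseteq> X \<and> fst B \<subseteq> Y \<and> fst C \<subseteq> Y)"
    for A B C :: "'v set \<times> 'v set set"
  have swap: "alone A B C \<Longrightarrow> alone A C B" for A B C unfolding alone_def by blast
  have split: "alone A B C \<or> alone B A C"
    if blocks: "is_block (V, E) A" "is_block (V, E) B" "is_block (V, E) C" and "A \<noteq> B" for A B C
  proof -
    obtain X Y c where sep: "separation E V X Y c" "fst A \<subseteq> X" "fst B \<subseteq> Y"
      using distinct_blocks_separated[OF G con blocks(1,2) \<open>A \<noteq> B\<close>] by blast
    have "fst C \<subseteq> X \<or> fst C \<subseteq> Y" using separation_biconnected[OF sep(1)] bi[OF blocks(3)] by blast
    then show ?thesis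
    proof
      assume "fst C \<subseteq> X"
      then have "alone B A C" unfolding alone_def using separation_sym[OF sep(1)] sep(2,3) by blast
      then show ?thesis ..
    next
      assume "fst C \<subseteq> Y"
      then have "alone A B C" unfolding alone_def using sep by blast
      then show ?thesis ..
    qed
  qed
  have two: False
    if "alone A B C" "alone B A C" "is_block (V, E) A" "\<not> bipartite A"
      "is_block (V, E) B" "\<not> bipartite B" "is_block (V, E) C" "\<not> bipartite C" for A B C
    using that(1,2) no_three_nonbipartite_aux[OF G con CI that(3-8)] unfolding alone_def by blast
  show False
    using split[OF B(1,3,5) neq(1)] split[OF B(1,5,3) neq(2)] split[OF B(3,5,1) neq(3)]
      two[of B1 B2 B3] two[of B1 B3 B2] two[of B2 B3 B1] swap B by blast
qed

theorem theorem4p2: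
  fixes V :: "'v set" and E :: "'v set set"
  assumes "simple_graph V E"
    and "connected_graph V E"
    and "graph_complete_intersection TYPE('k::field) E"
  shows "(let N = {B. is_block (V, E) B \<and> \<not> bipartite B} in
           N = {} \<or>
           (\<exists>B. N = {B}) \<or>
           (\<exists>B1 B2. B1 \<noteq> B2 \<and> N = {B1, B2} \<and> contiguous (V, E) B1 B2))"
proof -
  define N where "N = {B. is_block (V, E) B \<and> \<not> bipartite B}"
  have "\<exists>B1 B2. B1 \<noteq> B2 \<and> N = {B1, B2} \<and> contiguous (V, E) B1 B2"
    if N: "N \<noteq> {}" "\<nexists>B. N = {B}"
  proof -
    obtain B1 where B1: "B1 \<in> N" using N(1) by blast
    then obtain B2 where B2: "B2 \<in> N" "B1 \<noteq> B2" using N(2) by blast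
    have "B = B1 \<or> B = B2" if "B \<in> N" for B
      using no_three_nonbipartite[OF assms, of B1 B2 B] B1 B2 that by (auto simp: N_def)
    then have "N = {B1, B2}" using B1 B2 by blast
    moreover have "contiguous (V, E) B1 B2"
      using nonbipartite_blocks_contiguous[OF assms] B1 B2 by (simp add: N_def)
    ultimately show ?thesis using B2(2) by blast
  qed
  then show ?thesis unfolding Let_def N_def[symmetric] by blast
qed

end
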